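(* The consistent term model semantics is fully abstract with respect to $(Ob,\{\cup,\overline{(\cdot)}^{\sigma},(\cdot)\setminus\sigma,\rho(\cdot)\})$. That is, for all program modules $\mathcal P,\mathcal Q$ over $\Sigma$: if $Ob(C[\![\mathcal P]\!])=Ob(C[\![\mathcal Q]\!])$ for every context $C[\![\mathcal X]\!]$ built with these operations, then $\mathcal P\equiv_{CM}\mathcal Q$.
   Context: Terms. $\Sigma=(DS_\Sigma,FS_\Sigma)$ consists of countable disjoint sets of constructor symbols and of (defined) function symbols, each with an arity; $DS^n_\Sigma$, $FS^n_\Sigma$ are the symbols of arity $n\ge 0$. $\mathcal V$ is a countably infinite set of variables; $\bot$ is an extra 0-ary constructor. $\mathbf{Term}_\bot$ is the set of terms over $DS_\Sigma\cup FS_\Sigma\cup\{\bot\}$ and $\mathcal V$; $\mathbf{CTerm}_\bot$ is the subset of terms without function symbols; $\mathbf{Term}$, $\mathbf{CTerm}$ are the respective subsets of terms not containing $\bot$. $\mathbf{CSubst}_\bot$ (resp. $\mathbf{CSubst}$) is the set of maps $\theta:\mathcal V\to\mathbf{CTerm}_\bot$ (resp. $\mathcal V\to\mathbf{CTerm}$), extended to terms and written $t\theta$. Formulas are reduction statements $a\to b$ and joinability statements $a\bowtie b$ with $a,b\in\mathbf{Term}_\bot$. $\sqsubseteq$ is the least partial order on $\mathbf{CTerm}_\bot$ with $\bot\sqsubseteq t$ and $c(\overline s)\sqsubseteq c(\overline t)$ whenever $c\in DS^n_\Sigma$ and $s_i\sqsubseteq t_i$ for all $i$; $\langle t\rangle=\{s\in\mathbf{CTerm}_\bot\mid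 s\sqsubseteq t\}$. A cone is a non-empty subset of $\mathbf{CTerm}_\bot$ closed downwards under $\sqsubseteq$. Programs. A program is a set $\mathcal R$ of rules $f(\overline t)\to r\Leftarrow C$ with $f\in FS^n_\Sigma$, $\overline t$ an $n$-tuple of terms of $\mathbf{CTerm}$ in which no variable occurs twice, $r\in\mathbf{Term}_\bot$, and $C$ a finite set of joinability statements between terms of $\mathbf{Term}$. $[\mathcal R]_\bot$ is the set of all instances $(l\to r\Leftarrow C)\theta$ of rules of $\mathcal R$ with $\theta\in\mathbf{CSubst}_\bot$. Provability. $\mathcal R\vdash_{CRWL}\varphi$ means $\varphi$ is derivable with: (Bo) $e\to\bot$ for $e\in\mathbf{Term}_\bot$; (RR) $e\to e$ for $e\in\mathcal V\cup DS^0_\Sigma$; (DS) from $e_i\to t_i$ ($1\le i\le n$) infer $c(\overline e)\to c(\overline t)$, for $c\in DS^n_\Sigma$; (OR) from $e_i\to t_i$ ($1\le i\le n$), all statements of $C$, and $r\to t$ infer $f(\overline e)\to t$, if $(f(\overline t)\to r\Leftarrow C)\in[\mathcal R]_\bot$ and $t\neq\bot$; (Jo) from $a\to t$ and $b\to t$ infer $a\bowtie b$, if $t\in\mathbf{CTerm}$. Term algebras. A (CRWL-)term algebra $\mathcal A$ has carrier $\mathbf{CTerm}_\bot$, interprets each $c\in DS^n_\Sigma$ by $c^{\mathcal A}(\overline t)=\langle c(\overline t)\rangle$, and each $f\in FS^n_\Sigma$ by a monotonic map $f^{\mathcal A}$ from $(\mathbf{CTerm}_\bot)^n$ to cones ordered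 by inclusion (a cone if $n=0$). $\mathbf{TAlg}_\Sigma$ is the set of them, ordered by $\mathcal A\sqsubseteq\mathcal B$ iff $f^{\mathcal A}(\overline t)\subseteq f^{\mathcal B}(\overline t)$ for all $f,\overline t$. $\mathcal A$ is consistent iff $\{u\theta\mid u\in f^{\mathcal A}(\overline t)\}\subseteq f^{\mathcal A}(\overline t\theta)$ for all $f\in FS^n_\Sigma$, $t_i\in\mathbf{CTerm}_\bot$, $\theta\in\mathbf{CSubst}$; $\mathbf{CTAlg}_\Sigma$ is the set of consistent term algebras. Evaluation under $\eta:\mathcal V\to\mathbf{CTerm}_\bot$: $[\![\bot]\!]^{\mathcal A}_\eta=\langle\bot\rangle$, $[\![X]\!]^{\mathcal A}_\eta=\langle\eta(X)\rangle$, $[\![h(e_1,\dots,e_n)]\!]^{\mathcal A}_\eta=\bigcup\{h^{\mathcal A}(u_1,\dots,u_n)\mid u_i\in[\![e_i]\!]^{\mathcal A}_\eta\}$. $id$ is the identity valuation. $\mathcal A\models_\eta a\bowtie b$ iff $[\![a]\!]^{\mathcal A}_\eta\cap[\![b]\!]^{\mathcal A}_\eta$ contains an element of $\mathbf{CTerm}$ (a maximal element); $\mathcal A\models_\eta C$ iff this holds for all statements of $C$. For a program $\mathcal R$, $\mathcal T_{\mathcal R}:\mathbf{TAlg}_\Sigma\to\mathbf{TAlg}_\Sigma$ is given by $f^{\mathcal T_{\mathcal R}(\mathcal A)}(\overline t)=\{t\mid\exists(f(\overline s)\to r\Leftarrow C)\in[\mathcal R]_\bot,\ s_i\sqsubseteq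 t_i\text{ for all }i,\ \mathcal A\models_{id}C,\ t\in[\![r]\!]^{\mathcal A}_{id}\}\cup\{\bot\}$. $\mathcal M_{\mathcal R}$ is the term algebra with $f^{\mathcal M_{\mathcal R}}(\overline t)=\{r\in\mathbf{CTerm}_\bot\mid\mathcal R\vdash_{CRWL}f(\overline t)\to r\}$. Modules. A module is $\mathcal P=\langle\sigma_p,\sigma_e,\mathcal R\rangle$ with $\mathcal R$ a program whose rules have right-hand sides $r\ne\bot$, $\sigma_e=exp(\mathcal P)$ the set of function symbols having a defining rule in $\mathcal R$, and $\sigma_p$ the set of function symbols occurring in $\mathcal R$ without a defining rule in $\mathcal R$; $rl(\mathcal P)=\mathcal R$, and $\mathcal T_{\mathcal P}$, $\mathcal M_{\mathcal P}$ mean $\mathcal T_{rl(\mathcal P)}$, $\mathcal M_{rl(\mathcal P)}$. A module is determined by its rules. Operations ($\sigma\subseteq FS_\Sigma$): - union: $rl(\mathcal P_1\cup\mathcal P_2)=rl(\mathcal P_1)\cup rl(\mathcal P_2)$; - deletion: $rl(\mathcal P\setminus\sigma)$ is the set of rules of $\mathcal P$ that define function symbols not in $\sigma$; - closure: $rl(\overline{\mathcal P}^{\sigma})=\{crr(f(\overline t),r)\mid f\in\sigma,\ t_i\in\mathbf{CTerm}_\bot,\ r\in\mathbf{CTerm}_\bot,\ r\ne\bot,\ rl(\mathcal P)\vdash_{CRWL}f(\overline t)\to r\}$, where $crr(f(\overline t),r)$ is the rule $f(\overline t')\to r\Leftarrow C$ obtained by replacing in $\overline t$ each occurrence of $\bot$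 and each occurrence other than the first of a variable occurring more than once by a distinct fresh variable, and letting $C$ consist of $X\bowtie Y$ for each fresh $Y$ replacing an occurrence of a repeated variable $X$, and $X\bowtie X$ for each variable $X$ of $r$ and each variable $X$ occurring exactly once in $\overline t$; - renaming: a function symbol renaming is a map $\rho:FS_\Sigma\to FS_\Sigma$ preserving arities; it acts on terms and rules by replacing every function symbol $f$ by $\rho(f)$ (constructors, variables and $\bot$ fixed), and $rl(\rho(\mathcal P))=\{\rho(R)\mid R\in rl(\mathcal P)\}$. Semantics. $Ob(\mathcal P)=\mathcal M_{\mathcal P}$. Contexts are defined inductively: the metavariable $\mathcal X$ and each module are contexts, and an operation (union, closure wrt any $\sigma$, deletion of any $\sigma$, renaming by any $\rho$) applied to contexts is a context; $C[\![\mathcal P]\!]$ is the result of replacing $\mathcal X$ by $\mathcal P$. The consistent term model semantics of $\mathcal P$ is the set of its consistent term models, equivalently $\{\mathcal A\in\mathbf{CTAlg}_\Sigma\mid\mathcal T_{\mathcal P}(\mathcal A)\sqsubseteq\mathcal A\}$; $\mathcal P\equiv_{CM}\mathcal Q$ iff for all $\mathcal A\in\mathbf{CTAlg}_\Sigma$: $\mathcal T_{\mathcal P}(\mathcal A)\sqsubseteq\mathcal A\Leftrightarrow\mathcal T_{\mathcal Q}(\mathcal A)\sqsubseteq\mathcal A$. *)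

theory Defs
  imports Main "HOL-Library.Countable_Set"
begin

section \<open>Signatures and terms\<close>

text \<open>A signature assigns an arity to each of its symbols; symbols mapped to \<^const>\<open>None\<close> do not
  belong to it, so either set of symbols may be empty.  Constructor and function symbols live in
  different types, hence are disjoint.\<close>

record ('c, 'f) signature =
  con_ar :: "'c \<rightharpoonup> nat"
  fun_ar :: "'f \<rightharpoonup> nat"

definition DS :: "('c, 'f) signature \<Rightarrow> nat \<Rightarrow> 'c set" where
  "DS \<Sigma> n = {c. con_ar \<Sigma> c = Some n}"

definition FS :: "('c, 'f) signature \<Rightarrow> nat \<Rightarrow> 'f set" where
  "FS \<Sigma> n = {f. fun_ar \<Sigma> f = Some n}"

definition countable_signature :: "('c, 'f) signature \<Rightarrow> bool" where
  "countable_signature \<Sigma> \<longleftrightarrow> countable (\<Union>n. DS \<Sigma> n) \<and> countable (\<Union>n. FS \<Sigma> n)"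

text \<open>The countably infinite set of variables is \<^typ>\<open>nat\<close>.  The type \<open>tm\<close> contains raw terms;
  arities are imposed by \<open>Term_bot\<close>.  The datatype also provides \<open>funsyms t\<close>, the set of function
  symbols occurring in \<open>t\<close>, and \<open>map_tm\<close>, which renames symbols.\<close>

datatype (consyms: 'c, funsyms: 'f) tm =
    Bot
  | Var nat
  | Con 'c "('c, 'f) tm list"
  | Fun 'f "('c, 'f) tm list"
  for map: map_tm

inductive_set Term_bot :: "('c, 'f) signature \<Rightarrow> ('c, 'f) tm set" for \<Sigma> where
  "Bot \<in> Term_bot \<Sigma>"
| "Var x \<in> Term_bot \<Sigma>"
| "\<lbrakk>c \<in> DS \<Sigma> n; length ts = n; \<And>t. t \<in> set ts \<Longrightarrow> t \<in> Term_bot \<Sigma>\<rbrakk> \<Longrightarrow> Con c ts \<in> Term_bot \<Sigma>"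
| "\<lbrakk>f \<in> FS \<Sigma> n; length ts = n; \<And>t. t \<in> set ts \<Longrightarrow> t \<in> Term_bot \<Sigma>\<rbrakk> \<Longrightarrow> Fun f ts \<in> Term_bot \<Sigma>"

fun bot_free :: "('c, 'f) tm \<Rightarrow> bool" where
  "bot_free Bot \<longleftrightarrow> False"
| "bot_free (Var x) \<longleftrightarrow> True"
| "bot_free (Con c ts) \<longleftrightarrow> (\<forall>t \<in> set ts. bot_free t)"
| "bot_free (Fun f ts) \<longleftrightarrow> (\<forall>t \<in> set ts. bot_free t)"

definition CTerm_bot :: "('c, 'f) signature \<Rightarrow> ('c, 'f) tm set" where
  "CTerm_bot \<Sigma> = {t \<in> Term_bot \<Sigma>. funsyms t = {}}"

definition Term :: "('c, 'f) signature \<Rightarrow> ('c, 'f) tm set" where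
  "Term \<Sigma> = {t \<in> Term_bot \<Sigma>. bot_free t}"

definition CTerm :: "('c, 'f) signature \<Rightarrow> ('c, 'f) tm set" where
  "CTerm \<Sigma> = {t \<in> CTerm_bot \<Sigma>. bot_free t}"

definition CTuple_bot :: "('c, 'f) signature \<Rightarrow> nat \<Rightarrow> ('c, 'f) tm list set" where
  "CTuple_bot \<Sigma> n = {ts. length ts = n \<and> set ts \<subseteq> CTerm_bot \<Sigma>}"

text \<open>Variable occurrences from left to right, with repetitions.\<close>

fun var_occs :: "('c, 'f) tm \<Rightarrow> nat list" where
  "var_occs Bot = []"
| "var_occs (Var x) = [x]"
| "var_occs (Con c ts) = concat (map var_occs ts)"
| "var_occs (Fun f ts) = concat (map var_occs ts)"

definition tuple_var_occs :: "('c, 'f) tm list \<Rightarrow> nat list" where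
  "tuple_var_occs ts = concat (map var_occs ts)"

fun subst :: "(nat \<Rightarrow> ('c, 'f) tm) \<Rightarrow> ('c, 'f) tm \<Rightarrow> ('c, 'f) tm" where
  "subst \<theta> Bot = Bot"
| "subst \<theta> (Var x) = \<theta> x"
| "subst \<theta> (Con c ts) = Con c (map (subst \<theta>) ts)"
| "subst \<theta> (Fun f ts) = Fun f (map (subst \<theta>) ts)"

definition CSubst_bot :: "('c, 'f) signature \<Rightarrow> (nat \<Rightarrow> ('c, 'f) tm) set" where
  "CSubst_bot \<Sigma> = {\<theta>. \<forall>x. \<theta> x \<in> CTerm_bot \<Sigma>}"

definition CSubst :: "('c, 'f) signature \<Rightarrow> (nat \<Rightarrow> ('c, 'f) tm) set" where
  "CSubst \<Sigma> = {\<theta>. \<forall>x. \<theta> x \<in> CTerm \<Sigma>}"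

text \<open>The least preorder with the two required closure properties; it is antisymmetric, hence also
  the least such partial order.\<close>

inductive info_le :: "('c, 'f) signature \<Rightarrow> ('c, 'f) tm \<Rightarrow> ('c, 'f) tm \<Rightarrow> bool" for \<Sigma> where
  refl: "t \<in> CTerm_bot \<Sigma> \<Longrightarrow> info_le \<Sigma> t t"
| trans: "\<lbrakk>info_le \<Sigma> s t; info_le \<Sigma> t u\<rbrakk> \<Longrightarrow> info_le \<Sigma> s u"
| bot: "t \<in> CTerm_bot \<Sigma> \<Longrightarrow> info_le \<Sigma> Bot t"
| con: "\<lbrakk>c \<in> DS \<Sigma> n; length ss = n; length ts = n; \<And>i. i < n \<Longrightarrow> info_le \<Sigma> (ss ! i) (ts ! i)\<rbrakk>
    \<Longrightarrow> info_le \<Sigma> (Con c ss) (Con c ts)"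

definition down :: "('c, 'f) signature \<Rightarrow> ('c, 'f) tm \<Rightarrow> ('c, 'f) tm set" where
  "down \<Sigma> t = {s \<in> CTerm_bot \<Sigma>. info_le \<Sigma> s t}"

definition cone :: "('c, 'f) signature \<Rightarrow> ('c, 'f) tm set \<Rightarrow> bool" where
  "cone \<Sigma> S \<longleftrightarrow> S \<noteq> {} \<and> S \<subseteq> CTerm_bot \<Sigma> \<and>
     (\<forall>t \<in> S. \<forall>s \<in> CTerm_bot \<Sigma>. info_le \<Sigma> s t \<longrightarrow> s \<in> S)"

section \<open>Programs and provability\<close>

text \<open>\<open>Rule f ts r C\<close> is the rule \<open>f(ts) \<rightarrow> r \<Leftarrow> C\<close>; a pair \<open>(a, b)\<close> in \<open>C\<close> is the joinability
  statement \<open>a \<bowtie> b\<close>.\<close>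

datatype ('c, 'f) rule =
  Rule (rule_fun: 'f) (rule_args: "('c, 'f) tm list") (rule_rhs: "('c, 'f) tm")
    (rule_conds: "(('c, 'f) tm \<times> ('c, 'f) tm) set")

definition program_rule :: "('c, 'f) signature \<Rightarrow> ('c, 'f) rule \<Rightarrow> bool" where
  "program_rule \<Sigma> R \<longleftrightarrow>
     rule_fun R \<in> FS \<Sigma> (length (rule_args R)) \<and>
     set (rule_args R) \<subseteq> CTerm \<Sigma> \<and> distinct (tuple_var_occs (rule_args R)) \<and>
     rule_rhs R \<in> Term_bot \<Sigma> \<and>
     finite (rule_conds R) \<and> rule_conds R \<subseteq> Term \<Sigma> \<times> Term \<Sigma>"

definition program :: "('c, 'f) signature \<Rightarrow> ('c, 'f) rule set \<Rightarrow> bool" where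
  "program \<Sigma> \<R> \<longleftrightarrow> (\<forall>R \<in> \<R>. program_rule \<Sigma> R)"

fun subst_rule :: "(nat \<Rightarrow> ('c, 'f) tm) \<Rightarrow> ('c, 'f) rule \<Rightarrow> ('c, 'f) rule" where
  "subst_rule \<theta> (Rule f ts r C) =
     Rule f (map (subst \<theta>) ts) (subst \<theta> r) ((\<lambda>(a, b). (subst \<theta> a, subst \<theta> b)) ` C)"

definition instances :: "('c, 'f) signature \<Rightarrow> ('c, 'f) rule set \<Rightarrow> ('c, 'f) rule set" where
  "instances \<Sigma> \<R> = {subst_rule \<theta> R | \<theta> R. \<theta> \<in> CSubst_bot \<Sigma> \<and> R \<in> \<R>}"

text \<open>\<open>Red a b\<close> is the reduction statement \<open>a \<rightarrow> b\<close>, and \<open>Join a b\<close> is \<open>a \<bowtie> b\<close>.\<close>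

datatype ('c, 'f) formula =
    Red "('c, 'f) tm" "('c, 'f) tm"
  | Join "('c, 'f) tm" "('c, 'f) tm"

inductive crwl :: "('c, 'f) signature \<Rightarrow> ('c, 'f) rule set \<Rightarrow> ('c, 'f) formula \<Rightarrow> bool"
  for \<Sigma> \<R> where
  Bo: "e \<in> Term_bot \<Sigma> \<Longrightarrow> crwl \<Sigma> \<R> (Red e Bot)"
| RR_var: "crwl \<Sigma> \<R> (Red (Var x) (Var x))"
| RR_con: "c \<in> DS \<Sigma> 0 \<Longrightarrow> crwl \<Sigma> \<R> (Red (Con c []) (Con c []))"
| DS: "\<lbrakk>c \<in> DS \<Sigma> n; length es = n; length ts = n;
       \<And>i. i < n \<Longrightarrow> crwl \<Sigma> \<R> (Red (es ! i) (ts ! i))\<rbrakk>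
    \<Longrightarrow> crwl \<Sigma> \<R> (Red (Con c es) (Con c ts))"
| OR: "\<lbrakk>Rule f ts r C \<in> instances \<Sigma> \<R>; f \<in> FS \<Sigma> n; length es = n; length ts = n;
       \<And>i. i < n \<Longrightarrow> crwl \<Sigma> \<R> (Red (es ! i) (ts ! i));
       \<And>a b. (a, b) \<in> C \<Longrightarrow> crwl \<Sigma> \<R> (Join a b);
       crwl \<Sigma> \<R> (Red r t); t \<noteq> Bot\<rbrakk>
    \<Longrightarrow> crwl \<Sigma> \<R> (Red (Fun f es) t)"
| Jo: "\<lbrakk>crwl \<Sigma> \<R> (Red a t); crwl \<Sigma> \<R> (Red b t); t \<in> CTerm \<Sigma>\<rbrakk>
    \<Longrightarrow> crwl \<Sigma> \<R> (Join a b)"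

section \<open>Term algebras\<close>

text \<open>The carrier and the constructors have a fixed interpretation, so a term algebra is given by the
  interpretation of the function symbols.  It is required to be \<open>{}\<close> outside its intended domain
  (a cone is never empty), which makes equality of term algebras extensional.\<close>

type_synonym ('c, 'f) alg = "'f \<Rightarrow> ('c, 'f) tm list \<Rightarrow> ('c, 'f) tm set"

definition TAlg :: "('c, 'f) signature \<Rightarrow> ('c, 'f) alg set" where
  "TAlg \<Sigma> = {\<A>.
     (\<forall>n. \<forall>f \<in> FS \<Sigma> n.
        (\<forall>ts \<in> CTuple_bot \<Sigma> n. cone \<Sigma> (\<A> f ts)) \<and>
        (\<forall>ss \<in> CTuple_bot \<Sigma> n. \<forall>ts \<in> CTuple_bot \<Sigma> n.
           list_all2 (info_le \<Sigma>) ss ts \<longrightarrow> \<A> f ss \<subseteq> \<A> f ts)) \<and>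
     (\<forall>f ts. (\<nexists>n. f \<in> FS \<Sigma> n \<and> ts \<in> CTuple_bot \<Sigma> n) \<longrightarrow> \<A> f ts = {})}"

definition alg_le :: "('c, 'f) signature \<Rightarrow> ('c, 'f) alg \<Rightarrow> ('c, 'f) alg \<Rightarrow> bool" where
  "alg_le \<Sigma> \<A> \<B> \<longleftrightarrow> (\<forall>n. \<forall>f \<in> FS \<Sigma> n. \<forall>ts \<in> CTuple_bot \<Sigma> n. \<A> f ts \<subseteq> \<B> f ts)"

definition consistent :: "('c, 'f) signature \<Rightarrow> ('c, 'f) alg \<Rightarrow> bool" where
  "consistent \<Sigma> \<A> \<longleftrightarrow>
     (\<forall>n. \<forall>f \<in> FS \<Sigma> n. \<forall>ts \<in> CTuple_bot \<Sigma> n. \<forall>\<theta> \<in> CSubst \<Sigma>.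
        {subst \<theta> u | u. u \<in> \<A> f ts} \<subseteq> \<A> f (map (subst \<theta>) ts))"

definition CTAlg :: "('c, 'f) signature \<Rightarrow> ('c, 'f) alg set" where
  "CTAlg \<Sigma> = {\<A> \<in> TAlg \<Sigma>. consistent \<Sigma> \<A>}"

text \<open>\<open>listset [S\<^sub>1, \<dots>, S\<^sub>n]\<close> is the set of all lists \<open>[u\<^sub>1, \<dots>, u\<^sub>n]\<close> with \<open>u\<^sub>i \<in> S\<^sub>i\<close>.\<close>

fun eval :: "('c, 'f) signature \<Rightarrow> ('c, 'f) alg \<Rightarrow> (nat \<Rightarrow> ('c, 'f) tm) \<Rightarrow> ('c, 'f) tm
    \<Rightarrow> ('c, 'f) tm set" where
  "eval \<Sigma> \<A> \<eta> Bot = down \<Sigma> Bot"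
| "eval \<Sigma> \<A> \<eta> (Var x) = down \<Sigma> (\<eta> x)"
| "eval \<Sigma> \<A> \<eta> (Con c es) = (\<Union>us \<in> listset (map (eval \<Sigma> \<A> \<eta>) es). down \<Sigma> (Con c us))"
| "eval \<Sigma> \<A> \<eta> (Fun f es) = (\<Union>us \<in> listset (map (eval \<Sigma> \<A> \<eta>) es). \<A> f us)"

definition sat_join :: "('c, 'f) signature \<Rightarrow> ('c, 'f) alg \<Rightarrow> (nat \<Rightarrow> ('c, 'f) tm)
    \<Rightarrow> ('c, 'f) tm \<Rightarrow> ('c, 'f) tm \<Rightarrow> bool" where
  "sat_join \<Sigma> \<A> \<eta> a b \<longleftrightarrow> (\<exists>t \<in> CTerm \<Sigma>. t \<in> eval \<Sigma> \<A> \<eta> a \<inter> eval \<Sigma> \<A> \<eta> b)"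

definition sat_conds :: "('c, 'f) signature \<Rightarrow> ('c, 'f) alg \<Rightarrow> (nat \<Rightarrow> ('c, 'f) tm)
    \<Rightarrow> (('c, 'f) tm \<times> ('c, 'f) tm) set \<Rightarrow> bool" where
  "sat_conds \<Sigma> \<A> \<eta> C \<longleftrightarrow> (\<forall>(a, b) \<in> C. sat_join \<Sigma> \<A> \<eta> a b)"

text \<open>The identity valuation is \<^const>\<open>Var\<close>.\<close>

definition T_op :: "('c, 'f) signature \<Rightarrow> ('c, 'f) rule set \<Rightarrow> ('c, 'f) alg \<Rightarrow> ('c, 'f) alg" where
  "T_op \<Sigma> \<R> \<A> = (\<lambda>f ts.
     if \<exists>n. f \<in> FS \<Sigma> n \<and> ts \<in> CTuple_bot \<Sigma> n
     then {t. \<exists>ss r C. Rule f ss r C \<in> instances \<Sigma> \<R> \<and> list_all2 (info_le \<Sigma>) ss ts \<and>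
                sat_conds \<Sigma> \<A> Var C \<and> t \<in> eval \<Sigma> \<A> Var r} \<union> {Bot}
     else {})"

definition M_alg :: "('c, 'f) signature \<Rightarrow> ('c, 'f) rule set \<Rightarrow> ('c, 'f) alg" where
  "M_alg \<Sigma> \<R> = (\<lambda>f ts.
     if \<exists>n. f \<in> FS \<Sigma> n \<and> ts \<in> CTuple_bot \<Sigma> n
     then {r \<in> CTerm_bot \<Sigma>. crwl \<Sigma> \<R> (Red (Fun f ts) r)}
     else {})"

section \<open>Modules\<close>

text \<open>A module \<open>\<langle>\<sigma>\<^sub>p, \<sigma>\<^sub>e, \<R>\<rangle>\<close> is determined by its rules: \<open>\<sigma>\<^sub>p\<close> and \<open>\<sigma>\<^sub>e\<close> are functions of \<open>\<R>\<close>.  It is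
  therefore represented by \<open>\<R>\<close>, and the operations on modules act on sets of rules.\<close>

definition is_module :: "('c, 'f) signature \<Rightarrow> ('c, 'f) rule set \<Rightarrow> bool" where
  "is_module \<Sigma> \<P> \<longleftrightarrow> program \<Sigma> \<P> \<and> (\<forall>R \<in> \<P>. rule_rhs R \<noteq> Bot)"

definition mod_union :: "('c, 'f) rule set \<Rightarrow> ('c, 'f) rule set \<Rightarrow> ('c, 'f) rule set" where
  "mod_union \<P>\<^sub>1 \<P>\<^sub>2 = \<P>\<^sub>1 \<union> \<P>\<^sub>2"

definition mod_delete :: "'f set \<Rightarrow> ('c, 'f) rule set \<Rightarrow> ('c, 'f) rule set" where
  "mod_delete \<sigma> \<P> = {R \<in> \<P>. rule_fun R \<notin> \<sigma>}"

text \<open>\<open>linearize V k t\<close> traverses the constructor term \<open>t\<close> from left to right.  \<open>V\<close> is the set of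
  variables already met, and \<open>k, k + 1, \<dots>\<close> are the fresh variables still available.  The result
  consists of the linearized term, the updated \<open>V\<close> and \<open>k\<close>, and the statements \<open>X \<bowtie> Y\<close> for the fresh
  \<open>Y\<close> that have replaced a repeated occurrence of \<open>X\<close>.  The clause for \<^const>\<open>Fun\<close> is irrelevant.\<close>

fun linearize :: "nat set \<Rightarrow> nat \<Rightarrow> ('c, 'f) tm
      \<Rightarrow> ('c, 'f) tm \<times> nat set \<times> nat \<times> (('c, 'f) tm \<times> ('c, 'f) tm) set"
  and linearize_tuple :: "nat set \<Rightarrow> nat \<Rightarrow> ('c, 'f) tm list
      \<Rightarrow> ('c, 'f) tm list \<times> nat set \<times> nat \<times> (('c, 'f) tm \<times> ('c, 'f) tm) set" where
  "linearize V k Bot = (Var k, V, Suc k, {})"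
| "linearize V k (Var x) =
     (if x \<in> V then (Var k, V, Suc k, {(Var x, Var k)}) else (Var x, insert x V, k, {}))"
| "linearize V k (Con c ts) =
     (let (ts', V', k', C) = linearize_tuple V k ts in (Con c ts', V', k', C))"
| "linearize V k (Fun f ts) = (Fun f ts, V, k, {})"
| "linearize_tuple V k [] = ([], V, k, {})"
| "linearize_tuple V k (t # ts) =
     (let (t', V', k', C) = linearize V k t;
          (ts', V'', k'', C') = linearize_tuple V' k' ts
      in (t' # ts', V'', k'', C \<union> C'))"

text \<open>The fresh variables are those above every variable of \<open>f(ts)\<close> and \<open>r\<close>.\<close>

definition crr :: "'f \<Rightarrow> ('c, 'f) tm list \<Rightarrow> ('c, 'f) tm \<Rightarrow> ('c, 'f) rule" where
  "crr f ts r =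
     (let k = Suc (Max (insert 0 (set (tuple_var_occs ts) \<union> set (var_occs r))));
          (ts', _, _, C) = linearize_tuple {} k ts
      in Rule f ts' r
           (C \<union> {(Var x, Var x) | x.
                   x \<in> set (var_occs r) \<or> count_list (tuple_var_occs ts) x = 1}))"

definition mod_closure ::
    "('c, 'f) signature \<Rightarrow> 'f set \<Rightarrow> ('c, 'f) rule set \<Rightarrow> ('c, 'f) rule set" where
  "mod_closure \<Sigma> \<sigma> \<P> = {crr f ts r | f ts r n.
     f \<in> \<sigma> \<and> f \<in> FS \<Sigma> n \<and> ts \<in> CTuple_bot \<Sigma> n \<and> r \<in> CTerm_bot \<Sigma> \<and> r \<noteq> Bot \<and>
     crwl \<Sigma> \<P> (Red (Fun f ts) r)}"

definition fun_renaming :: "('c, 'f) signature \<Rightarrow> ('f \<Rightarrow> 'f) \<Rightarrow> bool" where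
  "fun_renaming \<Sigma> \<rho> \<longleftrightarrow> (\<forall>n. \<forall>f \<in> FS \<Sigma> n. \<rho> f \<in> FS \<Sigma> n)"

fun rename_rule :: "('f \<Rightarrow> 'f) \<Rightarrow> ('c, 'f) rule \<Rightarrow> ('c, 'f) rule" where
  "rename_rule \<rho> (Rule f ts r C) =
     Rule (\<rho> f) (map (map_tm id \<rho>) ts) (map_tm id \<rho> r)
       ((\<lambda>(a, b). (map_tm id \<rho> a, map_tm id \<rho> b)) ` C)"

definition mod_rename :: "('f \<Rightarrow> 'f) \<Rightarrow> ('c, 'f) rule set \<Rightarrow> ('c, 'f) rule set" where
  "mod_rename \<rho> \<P> = rename_rule \<rho> ` \<P>"

section \<open>Contexts and semantics\<close>

datatype ('c, 'f) ctxt =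
    Hole
  | Module "('c, 'f) rule set"
  | Union "('c, 'f) ctxt" "('c, 'f) ctxt"
  | Closure "'f set" "('c, 'f) ctxt"
  | Delete "'f set" "('c, 'f) ctxt"
  | Rename "'f \<Rightarrow> 'f" "('c, 'f) ctxt"

inductive_set Contexts :: "('c, 'f) signature \<Rightarrow> ('c, 'f) ctxt set" for \<Sigma> where
  "Hole \<in> Contexts \<Sigma>"
| "is_module \<Sigma> \<P> \<Longrightarrow> Module \<P> \<in> Contexts \<Sigma>"
| "\<lbrakk>K\<^sub>1 \<in> Contexts \<Sigma>; K\<^sub>2 \<in> Contexts \<Sigma>\<rbrakk> \<Longrightarrow> Union K\<^sub>1 K\<^sub>2 \<in> Contexts \<Sigma>"
| "\<lbrakk>\<sigma> \<subseteq> (\<Union>n. FS \<Sigma> n); K \<in> Contexts \<Sigma>\<rbrakk> \<Longrightarrow> Closure \<sigma> K \<in> Contexts \<Sigma>"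
| "\<lbrakk>\<sigma> \<subseteq> (\<Union>n. FS \<Sigma> n); K \<in> Contexts \<Sigma>\<rbrakk> \<Longrightarrow> Delete \<sigma> K \<in> Contexts \<Sigma>"
| "\<lbrakk>fun_renaming \<Sigma> \<rho>; K \<in> Contexts \<Sigma>\<rbrakk> \<Longrightarrow> Rename \<rho> K \<in> Contexts \<Sigma>"

fun plug :: "('c, 'f) signature \<Rightarrow> ('c, 'f) ctxt \<Rightarrow> ('c, 'f) rule set \<Rightarrow> ('c, 'f) rule set" where
  "plug \<Sigma> Hole \<P> = \<P>"
| "plug \<Sigma> (Module \<Q>) \<P> = \<Q>"
| "plug \<Sigma> (Union K\<^sub>1 K\<^sub>2) \<P> = mod_union (plug \<Sigma> K\<^sub>1 \<P>) (plug \<Sigma> K\<^sub>2 \<P>)"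
| "plug \<Sigma> (Closure \<sigma> K) \<P> = mod_closure \<Sigma> \<sigma> (plug \<Sigma> K \<P>)"
| "plug \<Sigma> (Delete \<sigma> K) \<P> = mod_delete \<sigma> (plug \<Sigma> K \<P>)"
| "plug \<Sigma> (Rename \<rho> K) \<P> = mod_rename \<rho> (plug \<Sigma> K \<P>)"

definition Ob :: "('c, 'f) signature \<Rightarrow> ('c, 'f) rule set \<Rightarrow> ('c, 'f) alg" where
  "Ob \<Sigma> \<P> = M_alg \<Sigma> \<P>"

definition CM_equiv ::
    "('c, 'f) signature \<Rightarrow> ('c, 'f) rule set \<Rightarrow> ('c, 'f) rule set \<Rightarrow> bool" where
  "CM_equiv \<Sigma> \<P> \<Q> \<longleftrightarrow>
     (\<forall>\<A> \<in> CTAlg \<Sigma>. alg_le \<Sigma> (T_op \<Sigma> \<P> \<A>) \<A> \<longleftrightarrow> alg_le \<Sigma> (T_op \<Sigma> \<Q> \<A>) \<A>)"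

end

theory Submission
  imports Defs
begin

text \<open>A consistent term algebra \<open>\<A>\<close> is the observable of a module: take all rules \<open>crr(f(t), r)\<close> with
  \<open>r \<in> f\<^sup>\<A>(t)\<close>.  Consistency makes \<open>\<A>\<close> a model of these rules, because the joinability conditions
  force the variables of \<open>t\<close> and \<open>r\<close> to be instantiated by total terms.  If \<open>\<A>\<close> is also a model of
  \<open>\<P>\<close>, then \<open>\<A>\<close> is the least model of \<open>\<P>\<close> united with these rules.  Contextual equivalence carries
  this over to \<open>\<Q>\<close> united with these rules, so \<open>\<A>\<close> is a model of \<open>\<Q>\<close>.\<close>

section \<open>Constructor terms and the information ordering\<close>

lemma Con_mem_Term_bot:
  "Con c ts \<in> Term_bot \<Sigma> \<longleftrightarrow> c \<in> DS \<Sigma> (length ts) \<and> set ts \<subseteq> Term_bot \<Sigma>"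
  by (auto intro: Term_bot.intros elim: Term_bot.cases)

lemma Fun_mem_Term_bot:
  "Fun f ts \<in> Term_bot \<Sigma> \<longleftrightarrow> f \<in> FS \<Sigma> (length ts) \<and> set ts \<subseteq> Term_bot \<Sigma>"
  by (auto intro: Term_bot.intros elim: Term_bot.cases)

lemma CTerm_bot_simps [simp]:
  "Bot \<in> CTerm_bot \<Sigma>"
  "Var x \<in> CTerm_bot \<Sigma>"
  "Con c ts \<in> CTerm_bot \<Sigma> \<longleftrightarrow> c \<in> DS \<Sigma> (length ts) \<and> set ts \<subseteq> CTerm_bot \<Sigma>"
  "Fun f ts \<notin> CTerm_bot \<Sigma>"
  by (auto simp: CTerm_bot_def Con_mem_Term_bot intro: Term_bot.intros)

lemma CTerm_bot_subset_Term_bot: "CTerm_bot \<Sigma> \<subseteq> Term_bot \<Sigma>"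
  by (auto simp: CTerm_bot_def)

lemma subst_mem_Term_bot:
  assumes "t \<in> Term_bot \<Sigma>" "\<theta> \<in> CSubst_bot \<Sigma>"
  shows "subst \<theta> t \<in> Term_bot \<Sigma>"
  using assms
proof (induction rule: Term_bot.induct)
  case (2 x)
  then show ?case
    using CTerm_bot_subset_Term_bot by (auto simp: CSubst_bot_def)
qed (auto simp: Con_mem_Term_bot Fun_mem_Term_bot intro: Term_bot.intros)

lemma subst_mem_CTerm_bot:
  "t \<in> CTerm_bot \<Sigma> \<Longrightarrow> \<theta> \<in> CSubst_bot \<Sigma> \<Longrightarrow> subst \<theta> t \<in> CTerm_bot \<Sigma>"
  by (induction t) (auto simp: CSubst_bot_def)

lemma subst_cong: "(\<And>x. x \<in> set (var_occs t) \<Longrightarrow> \<theta> x = \<theta>' x) \<Longrightarrow> subst \<theta> t = subst \<theta>' t"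
  by (induction t) auto

lemma subst_Var [simp]: "subst Var t = t"
  by (induction t) (auto intro: map_idI)

section \<open>Inversion and maximality in the information ordering\<close>

lemma info_le_CTerm_bot:
  "info_le \<Sigma> s t \<Longrightarrow> s \<in> CTerm_bot \<Sigma> \<and> t \<in> CTerm_bot \<Sigma>"
  by (induction rule: info_le.induct) (auto simp: set_conv_nth)

text \<open>Transitivity is an introduction rule of \<open>info_le\<close>, so the generated case
  rule says nothing about the shape of the terms. The three shapes listed here are preserved by
  composition, which lets a rule induction go through.\<close>

lemma info_le_cases:
  assumes "info_le \<Sigma> s t"
  obtains "s = Bot"
  | x where "s = Var x" "t = Var x"
  | c ss ts where "s = Con c ss" "t = Con c ts" "c \<in> DS \<Sigma> (length ts)" "list_all2 (info_le \<Sigma>) ss ts"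
proof -
  from assms have "s = Bot \<or> (\<exists>x. s = Var x \<and> t = Var x) \<or>
      (\<exists>c ss ts. s = Con c ss \<and> t = Con c ts \<and> c \<in> DS \<Sigma> (length ts) \<and> list_all2 (info_le \<Sigma>) ss ts)"
  proof (induction rule: info_le.induct)
    case (refl t)
    then show ?case
      by (cases t) (auto simp: list_all2_same intro: info_le.refl)
  next
    case (trans s t u)
    note tr = list_all2_trans[OF info_le.trans]
    from trans.IH show ?case
      by (elim disjE exE conjE) (auto intro: tr)
  qed (auto simp: list_all2_conv_all_nth)
  then show thesis
    by (elim disjE exE conjE) (rule that; assumption)+
qed

lemma info_le_Bot_iff [simp]: "info_le \<Sigma> t Bot \<longleftrightarrow> t = Bot"
  by (auto elim: info_le_cases intro: info_le.bot)

lemma info_le_Con: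
  "c \<in> DS \<Sigma> (length ts) \<Longrightarrow> list_all2 (info_le \<Sigma>) ss ts \<Longrightarrow> info_le \<Sigma> (Con c ss) (Con c ts)"
  by (auto simp: list_all2_conv_all_nth intro: info_le.con)

lemma list_all2_info_le_refl: "set ts \<subseteq> CTerm_bot \<Sigma> \<Longrightarrow> list_all2 (info_le \<Sigma>) ts ts"
  by (auto simp: list_all2_same intro: info_le.refl)

lemma list_all2_info_le_trans:
  "list_all2 (info_le \<Sigma>) ss ts \<Longrightarrow> list_all2 (info_le \<Sigma>) ts us \<Longrightarrow> list_all2 (info_le \<Sigma>) ss us"
  by (rule list_all2_trans[OF info_le.trans])

text \<open>A term can be properly enlarged only at an occurrence of \<open>Bot\<close>, so terms
  without \<open>Bot\<close> are maximal.\<close>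

lemma info_le_total: "info_le \<Sigma> s t \<Longrightarrow> bot_free s \<Longrightarrow> s = t"
  by (induction rule: info_le.induct) (auto simp: list_eq_iff_nth_eq)

section \<open>Evaluation\<close>

lemma listset_map_iff:
  "us \<in> listset (map g es) \<longleftrightarrow> list_all2 (\<lambda>u e. u \<in> g e) us es"
  by (induction es arbitrary: us) (auto simp: set_Cons_def list_all2_Cons2)

section \<open>Cones in term algebras and in evaluations\<close>

lemma TAlg_cone: "\<A> \<in> TAlg \<Sigma> \<Longrightarrow> f \<in> FS \<Sigma> n \<Longrightarrow> ts \<in> CTuple_bot \<Sigma> n \<Longrightarrow> cone \<Sigma> (\<A> f ts)"
  by (auto simp: TAlg_def)

lemma TAlg_mono:
  "\<A> \<in> TAlg \<Sigma> \<Longrightarrow> f \<in> FS \<Sigma> n \<Longrightarrow> ss \<in> CTuple_bot \<Sigma> n \<Longrightarrow> ts \<in> CTuple_bot \<Sigma> n \<Longrightarrow>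
    list_all2 (info_le \<Sigma>) ss ts \<Longrightarrow> \<A> f ss \<subseteq> \<A> f ts"
  unfolding TAlg_def by blast

lemma TAlg_outside:
  "\<A> \<in> TAlg \<Sigma> \<Longrightarrow> \<nexists>n. f \<in> FS \<Sigma> n \<and> ts \<in> CTuple_bot \<Sigma> n \<Longrightarrow> \<A> f ts = {}"
  unfolding TAlg_def by blast

lemma cone_Bot: "cone \<Sigma> S \<Longrightarrow> Bot \<in> S"
  unfolding cone_def by (metis CTerm_bot_simps(1) equals0I info_le.bot subsetD)

lemma cone_closed: "cone \<Sigma> S \<Longrightarrow> t \<in> S \<Longrightarrow> info_le \<Sigma> s t \<Longrightarrow> s \<in> S"
  by (simp add: cone_def info_le_CTerm_bot)

lemma cone_down: "t \<in> CTerm_bot \<Sigma> \<Longrightarrow> cone \<Sigma> (down \<Sigma> t)"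
  unfolding cone_def down_def using info_le.refl info_le.trans by blast

lemma cone_Union:
  "I \<noteq> {} \<Longrightarrow> (\<And>i. i \<in> I \<Longrightarrow> cone \<Sigma> (S i)) \<Longrightarrow> cone \<Sigma> (\<Union>i\<in>I. S i)"
  unfolding cone_def by (simp add: UN_subset_iff) blast

text \<open>These are the facts needed to take a union of cones indexed by argument tuples: the
  index set is non-empty, and its members are tuples over the carrier.\<close>

lemma listset_cones:
  assumes "\<And>e. e \<in> set es \<Longrightarrow> cone \<Sigma> (g e)"
  shows "listset (map g es) \<noteq> {}" "listset (map g es) \<subseteq> CTuple_bot \<Sigma> (length es)"
proof -
  \<comment> \<open>Every cone contains \<open>Bot\<close>, so the tuple consisting of
    \<open>Bot\<close> only is always available.\<close>
  have "map (\<lambda>_. Bot) es \<in> listset (map g es)"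
    using assms by (auto simp: listset_map_iff list_all2_map1 list_all2_same intro: cone_Bot)
  then show "listset (map g es) \<noteq> {}"
    by blast
  show "listset (map g es) \<subseteq> CTuple_bot \<Sigma> (length es)"
  proof
    fix us assume "us \<in> listset (map g es)"
    then have "length us = length es" "\<And>i. i < length es \<Longrightarrow> us ! i \<in> g (es ! i)"
      by (auto simp: listset_map_iff list_all2_conv_all_nth)
    moreover have "g (es ! i) \<subseteq> CTerm_bot \<Sigma>" if "i < length es" for i
      using assms[of "es ! i"] that by (simp add: cone_def)
    ultimately show "us \<in> CTuple_bot \<Sigma> (length es)"
      unfolding CTuple_bot_def by (auto simp: in_set_conv_nth) blast
  qed
qed

lemma cone_eval:
  assumes "\<A> \<in> TAlg \<Sigma>" "e \<in> Term_bot \<Sigma>"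
  shows "cone \<Sigma> (eval \<Sigma> \<A> Var e)"
  using assms(2)
proof (induction rule: Term_bot.induct)
  case (3 c n ts)
  note * = listset_cones[of ts \<Sigma> "eval \<Sigma> \<A> Var", OF 3(4)]
  show ?case
    unfolding eval.simps
  proof (intro cone_Union cone_down *)
    fix us assume "us \<in> listset (map (eval \<Sigma> \<A> Var) ts)"
    then show "Con c us \<in> CTerm_bot \<Sigma>"
      using * 3(1,2) by (auto simp: CTuple_bot_def)
  qed
next
  case (4 f n ts)
  note * = listset_cones[of ts \<Sigma> "eval \<Sigma> \<A> Var", OF 4(4)]
  show ?case
    unfolding eval.simps
    by (intro cone_Union *(1) TAlg_cone[OF assms(1) 4(1)]) (use *(2) 4(2) in auto)
qed (auto intro: cone_down)

text \<open>The argument tuple is the largest member of the product of the principal cones of its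
  entries, so the union over that product is a single principal cone.\<close>

lemma eval_CTerm_bot: "t \<in> CTerm_bot \<Sigma> \<Longrightarrow> eval \<Sigma> \<A> Var t = down \<Sigma> t"
proof (induction t)
  case (Con c es)
  then have ev: "map (eval \<Sigma> \<A> Var) es = map (down \<Sigma>) es"
    by auto
  have "down \<Sigma> (Con c us) \<subseteq> down \<Sigma> (Con c es)" if "us \<in> listset (map (down \<Sigma>) es)" for us
  proof -
    from that have "list_all2 (info_le \<Sigma>) us es"
      by (auto simp: listset_map_iff down_def elim: list_all2_mono)
    then have "info_le \<Sigma> (Con c us) (Con c es)"
      using Con.prems by (auto intro: info_le_Con)
    then show ?thesis
      by (auto simp: down_def intro: info_le.trans)
  qed
  moreover have "es \<in> listset (map (down \<Sigma>) es)"
    using Con.prems by (auto simp: listset_map_iff list_all2_same down_def intro: info_le.refl)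
  ultimately show ?case
    unfolding eval.simps ev by blast
qed auto

text \<open>A total element below both terms is maximal, hence equal to each of them. Through this
  fact the joinability conditions of a rule instance force equality and totality.\<close>

lemma sat_join_CTerm_bot:
  assumes "sat_join \<Sigma> \<A> Var s t" "s \<in> CTerm_bot \<Sigma>" "t \<in> CTerm_bot \<Sigma>"
  shows "s = t" "s \<in> CTerm \<Sigma>"
proof -
  from assms obtain u where "u \<in> CTerm \<Sigma>" "info_le \<Sigma> u s" "info_le \<Sigma> u t"
    by (auto simp: sat_join_def eval_CTerm_bot down_def)
  then show "s = t" "s \<in> CTerm \<Sigma>"
    by (auto simp: CTerm_def dest!: info_le_total)
qed

section \<open>Provability and term models\<close>

lemma instances_Un: "instances \<Sigma> (\<R> \<union> \<S>) = instances \<Sigma> \<R> \<union> instances \<Sigma> \<S>"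
  unfolding instances_def by blast

lemma program_instance:
  assumes "program \<Sigma> \<R>" "Rule f ss r C \<in> instances \<Sigma> \<R>"
  shows "f \<in> FS \<Sigma> (length ss)" "set ss \<subseteq> CTerm_bot \<Sigma>" "r \<in> Term_bot \<Sigma>"
    "C \<subseteq> Term_bot \<Sigma> \<times> Term_bot \<Sigma>"
proof -
  from assms(2) obtain \<theta> R where \<theta>: "\<theta> \<in> CSubst_bot \<Sigma>" and R: "R \<in> \<R>"
    and eq: "Rule f ss r C = subst_rule \<theta> R"
    unfolding instances_def by blast
  have "program_rule \<Sigma> R"
    using assms(1) R by (simp add: program_def)
  moreover obtain ss' r' C' where "R = Rule f ss' r' C'" "ss = map (subst \<theta>) ss'" "r = subst \<theta> r'"
    "C = (\<lambda>(a, b). (subst \<theta> a, subst \<theta> b)) ` C'"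
    using eq by (cases R) auto
  ultimately show "f \<in> FS \<Sigma> (length ss)" "set ss \<subseteq> CTerm_bot \<Sigma>" "r \<in> Term_bot \<Sigma>"
    "C \<subseteq> Term_bot \<Sigma> \<times> Term_bot \<Sigma>"
    using subst_mem_CTerm_bot[OF _ \<theta>] subst_mem_Term_bot[OF _ \<theta>]
    by (auto simp: program_rule_def CTerm_def Term_def subset_iff)
qed

section \<open>Derivations compared with evaluation in models\<close>

lemma crwl_info_le: "info_le \<Sigma> s t \<Longrightarrow> crwl \<Sigma> \<R> (Red t s)"
proof (induction t arbitrary: s)
  case (Con c ts)
  from Con.prems show ?case
  proof (cases rule: info_le_cases)
    case 1
    then show ?thesis
      using Con.prems info_le_CTerm_bot CTerm_bot_subset_Term_bot by (blast intro: crwl.Bo)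
  next
    case (3 c' ss ts')
    then show ?thesis
      using Con.IH by (auto simp: list_all2_conv_all_nth intro!: crwl.DS)
  qed simp
next
  case (Fun f ts)
  then show ?case
    using info_le_CTerm_bot by fastforce
qed (auto elim!: info_le_cases intro!: crwl.intros Term_bot.intros)

text \<open>No program rule applies to a constructor term, and the remaining reduction rules mirror
  the ordering. Together with \<open>crwl_info_le\<close>, reduction from a constructor term is
  exactly the converse of the information ordering.\<close>

lemma crwl_CTerm_bot:
  "crwl \<Sigma> \<R> (Red u t) \<Longrightarrow> u \<in> CTerm_bot \<Sigma> \<Longrightarrow> info_le \<Sigma> t u"
  by (induction "Red u t" arbitrary: u t rule: crwl.induct)
    (auto simp: list_all2_conv_all_nth subset_iff intro: info_le.refl info_le.bot intro!: info_le_Con)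

text \<open>One induction covers both kinds of statement, because \<open>OR\<close> has joinability
  premises and \<open>Jo\<close> has reduction premises. Well-formedness of both sides is carried
  along since \<open>DS\<close> and \<open>OR\<close> do not state it for the terms
  \<open>es\<close> and \<open>ts\<close>, and the case of \<open>OR\<close> relies on it.\<close>

lemma crwl_sound:
  assumes A: "\<A> \<in> TAlg \<Sigma>" and model: "alg_le \<Sigma> (T_op \<Sigma> \<R> \<A>) \<A>"
    and "crwl \<Sigma> \<R> \<phi>"
  shows "case \<phi> of Red e t \<Rightarrow> e \<in> Term_bot \<Sigma> \<and> t \<in> CTerm_bot \<Sigma> \<and> t \<in> eval \<Sigma> \<A> Var e
    | Join a b \<Rightarrow> sat_join \<Sigma> \<A> Var a b"
  using assms(3)
proof (induction rule: crwl.induct)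
  case (Bo e)
  then show ?case
    using cone_Bot[OF cone_eval[OF A]] by simp
next
  case (DS c n es ts)
  then have t: "Con c ts \<in> CTerm_bot \<Sigma>" and e: "Con c es \<in> Term_bot \<Sigma>"
    by (auto simp: Con_mem_Term_bot in_set_conv_nth)
  have "ts \<in> listset (map (eval \<Sigma> \<A> Var) es)"
    using DS by (auto simp: listset_map_iff list_all2_conv_all_nth)
  moreover have "Con c ts \<in> down \<Sigma> (Con c ts)"
    using t by (simp add: down_def info_le.refl del: CTerm_bot_simps)
  ultimately show ?case
    using t e by (auto simp del: CTerm_bot_simps)
next
  case (OR f ts r C n es t)
  then have e: "Fun f es \<in> Term_bot \<Sigma>" and ts: "ts \<in> CTuple_bot \<Sigma> n"
    by (auto simp: Fun_mem_Term_bot CTuple_bot_def in_set_conv_nth)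
  have mem: "ts \<in> listset (map (eval \<Sigma> \<A> Var) es)"
    using OR by (auto simp: listset_map_iff list_all2_conv_all_nth)
  \<comment> \<open>The rule instance is applied to its own parameter tuple \<open>ts\<close>, which
    is one of the tuples in the union defining the value of \<open>Fun f es\<close>.\<close>
  have "list_all2 (info_le \<Sigma>) ts ts"
    using ts by (auto simp: CTuple_bot_def intro: list_all2_info_le_refl)
  moreover have "sat_conds \<Sigma> \<A> Var C" "t \<in> eval \<Sigma> \<A> Var r"
    using OR.IH by (auto simp: sat_conds_def)
  ultimately have "t \<in> T_op \<Sigma> \<R> \<A> f ts"
    using OR.hyps(1,2) ts unfolding T_op_def by auto
  then have "t \<in> \<A> f ts"
    using model ts OR.hyps by (auto simp: alg_le_def)
  then have "t \<in> eval \<Sigma> \<A> Var (Fun f es)"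
    unfolding eval.simps using mem by blast
  then show ?case
    using e OR.IH(3) by (simp del: eval.simps)
next
  case (Jo a t b)
  then show ?case
    by (auto simp: sat_join_def)
qed (auto simp: down_def Con_mem_Term_bot intro: Term_bot.intros info_le.refl)

text \<open>Soundness places \<open>t\<close> in the evaluation of \<open>Fun f ts\<close>, a union
  over tuples below \<open>ts\<close>; monotonicity of \<A> moves it to the value at
  \<open>ts\<close> itself.\<close>

lemma M_alg_least:
  assumes A: "\<A> \<in> TAlg \<Sigma>" and model: "alg_le \<Sigma> (T_op \<Sigma> \<R> \<A>) \<A>"
  shows "alg_le \<Sigma> (M_alg \<Sigma> \<R>) \<A>"
  unfolding alg_le_def
proof (intro allI ballI subsetI)
  fix n f ts t
  assume f: "f \<in> FS \<Sigma> n" and ts: "ts \<in> CTuple_bot \<Sigma> n" and "t \<in> M_alg \<Sigma> \<R> f ts"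
  then have "crwl \<Sigma> \<R> (Red (Fun f ts) t)"
    by (auto simp: M_alg_def split: if_splits)
  then have "t \<in> eval \<Sigma> \<A> Var (Fun f ts)"
    using crwl_sound[OF A model] by fastforce
  then obtain us where us: "us \<in> listset (map (eval \<Sigma> \<A> Var) ts)" and t: "t \<in> \<A> f us"
    by auto
  have "map (eval \<Sigma> \<A> Var) ts = map (down \<Sigma>) ts"
    using ts by (auto simp: CTuple_bot_def eval_CTerm_bot)
  with us have "list_all2 (info_le \<Sigma>) us ts" "us \<in> CTuple_bot \<Sigma> n"
    using ts
    by (auto simp: listset_map_iff CTuple_bot_def list_all2_conv_all_nth down_def in_set_conv_nth)
  then show "t \<in> \<A> f ts"
    using TAlg_mono[OF A f _ ts] t by blast
qed

text \<open>Downward closure of the denotations replaces the proof that provability is closed under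
  composition of reductions.\<close>

lemma crwl_complete:
  assumes "M_alg \<Sigma> \<R> \<in> TAlg \<Sigma>"
    and "e \<in> Term_bot \<Sigma>" "t \<in> eval \<Sigma> (M_alg \<Sigma> \<R>) Var e"
  shows "crwl \<Sigma> \<R> (Red e t)"
  using assms(2,3)
proof (induction arbitrary: t rule: Term_bot.induct)
  case (3 c n es)
  let ?ev = "eval \<Sigma> (M_alg \<Sigma> \<R>) Var"
  from 3(5) obtain us where us: "us \<in> listset (map ?ev es)" and t: "info_le \<Sigma> t (Con c us)"
    by (auto simp: down_def)
  from t show ?case
  proof (cases rule: info_le_cases)
    case 1
    then show ?thesis
      using 3(1-3) by (auto intro: crwl.Bo Term_bot.intros)
  next
    case ts: (3 c' ts us')
    have "length us = length es"
      using us by (auto simp: listset_map_iff list_all2_lengthD)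
    \<comment> \<open>The arguments of \<open>t\<close> lie below those of \<open>Con c us\<close>,
      and denotations are closed downwards, so the induction hypothesis applies to \<open>ts\<close>
      directly.\<close>
    moreover have "ts ! i \<in> ?ev (es ! i)" if "i < length es" for i
      using cone_closed[OF cone_eval[OF assms(1), of "es ! i"]] that us ts 3(3)
      by (auto simp: listset_map_iff list_all2_conv_all_nth)
    ultimately show ?thesis
      using 3(1,2,4) ts by (auto simp: list_all2_conv_all_nth intro!: crwl.DS)
  qed simp
next
  case (4 f n es)
  let ?ev = "eval \<Sigma> (M_alg \<Sigma> \<R>) Var"
  from 4(5) obtain us where us: "us \<in> listset (map ?ev es)" and "t \<in> M_alg \<Sigma> \<R> f us"
    by auto
  then have "crwl \<Sigma> \<R> (Red (Fun f us) t)" and set_us: "set us \<subseteq> CTerm_bot \<Sigma>"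
    by (auto simp: M_alg_def CTuple_bot_def split: if_splits)
  \<comment> \<open>The last rule of the derivation from \<open>Fun f us\<close> is inverted and
    then applied again with \<open>es\<close> in place of \<open>us\<close>.\<close>
  then show ?case
  proof (cases rule: crwl.cases)
    case Bo
    then show ?thesis
      using 4(1-3) by (auto intro: crwl.Bo Term_bot.intros)
  next
    case (OR ts r C m)
    have len: "length us = length es"
      using us by (auto simp: listset_map_iff list_all2_lengthD)
    \<comment> \<open>Reduction from the constructor term \<open>us ! i\<close> only goes down in
      the ordering, hence stays inside the cone that contains \<open>us ! i\<close>.\<close>
    have "ts ! i \<in> ?ev (es ! i)" if "i < m" for i
    proof -
      have "info_le \<Sigma> (ts ! i) (us ! i)"
        using OR(1,3-5) that set_us by (intro crwl_CTerm_bot) (auto simp: subset_iff)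
      moreover have "us ! i \<in> ?ev (es ! i)"
        using us OR that by (auto simp: listset_map_iff list_all2_conv_all_nth)
      moreover have "cone \<Sigma> (?ev (es ! i))"
        using cone_eval[OF assms(1)] 4(2,3) OR len that by simp
      ultimately show ?thesis
        using cone_closed by blast
    qed
    then have "crwl \<Sigma> \<R> (Red (es ! i) (ts ! i))" if "i < m" for i
      using 4(4) OR(3) len that by simp
    then show ?thesis
      using OR len by (intro crwl.OR[of f ts r C]) simp_all
  qed
qed (auto simp: down_def intro: crwl_info_le crwl.Bo Term_bot.intros)

text \<open>Completeness turns each ingredient of \<open>T_op\<close> into a premise of
  \<open>OR\<close>. Membership of the term model in \<open>TAlg\<close> is assumed because in the
  application the term model equals a given term algebra.\<close>

lemma M_alg_model:
  assumes prog: "program \<Sigma> \<R>" and M: "M_alg \<Sigma> \<R> \<in> TAlg \<Sigma>"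
  shows "alg_le \<Sigma> (T_op \<Sigma> \<R> (M_alg \<Sigma> \<R>)) (M_alg \<Sigma> \<R>)"
  unfolding alg_le_def
proof (intro allI ballI subsetI)
  fix n f ts t
  assume f: "f \<in> FS \<Sigma> n" and ts: "ts \<in> CTuple_bot \<Sigma> n"
    and t: "t \<in> T_op \<Sigma> \<R> (M_alg \<Sigma> \<R>) f ts"
  show "t \<in> M_alg \<Sigma> \<R> f ts"
  proof (cases "t = Bot")
    case True
    then show ?thesis
      using cone_Bot TAlg_cone[OF M f ts] by blast
  next
    case False
    with t obtain ss r C where inst: "Rule f ss r C \<in> instances \<Sigma> \<R>"
      and le: "list_all2 (info_le \<Sigma>) ss ts"
      and C: "sat_conds \<Sigma> (M_alg \<Sigma> \<R>) Var C" and r: "t \<in> eval \<Sigma> (M_alg \<Sigma> \<R>) Var r"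
      by (auto simp: T_op_def split: if_splits)
    note inst' = program_instance[OF prog inst]
    have "crwl \<Sigma> \<R> (Join a b)" if "(a, b) \<in> C" for a b
    proof -
      from C that obtain u where "u \<in> CTerm \<Sigma>"
        "u \<in> eval \<Sigma> (M_alg \<Sigma> \<R>) Var a" "u \<in> eval \<Sigma> (M_alg \<Sigma> \<R>) Var b"
        by (fastforce simp: sat_conds_def sat_join_def)
      then show ?thesis
        using crwl_complete[OF M] inst'(4) that by (blast intro: crwl.Jo)
    qed
    moreover have "crwl \<Sigma> \<R> (Red r t)"
      using crwl_complete[OF M inst'(3) r] .
    \<comment> \<open>The arguments \<open>ts\<close> reduce to the parameters \<open>ss\<close>
      because \<open>ss\<close> lies below \<open>ts\<close>.\<close>
    ultimately have "crwl \<Sigma> \<R> (Red (Fun f ts) t)"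
      using inst f ts le False
      by (intro crwl.OR[of f ss r C])
        (auto simp: list_all2_conv_all_nth CTuple_bot_def intro: crwl_info_le)
    moreover have "t \<in> CTerm_bot \<Sigma>"
      using cone_eval[OF M inst'(3)] r by (auto simp: cone_def)
    ultimately show ?thesis
      using f ts by (auto simp: M_alg_def)
  qed
qed

section \<open>Linearization\<close>

text \<open>The last two clauses are used in opposite directions: some instance of the linearized tuple is
  \<open>ts\<close> itself, and every instance that satisfies the joinability statements lies above the
  corresponding instance of \<open>ts\<close>.\<close>

definition linearization ::
    "('c, 'f) signature \<Rightarrow> nat set \<Rightarrow> nat \<Rightarrow> ('c, 'f) tm list
      \<Rightarrow> ('c, 'f) tm list \<times> nat set \<times> nat \<times> (('c, 'f) tm \<times> ('c, 'f) tm) set \<Rightarrow> bool" where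
  "linearization \<Sigma> V k ts = (\<lambda>(ts', V', k', C).
     k \<le> k' \<and> V' = V \<union> set (tuple_var_occs ts) \<and>
     length ts' = length ts \<and> set ts' \<subseteq> CTerm \<Sigma> \<and> distinct (tuple_var_occs ts') \<and>
     set (tuple_var_occs ts') \<subseteq> (set (tuple_var_occs ts) - V) \<union> {k..<k'} \<and>
     finite C \<and> C \<subseteq> (\<lambda>(x, y). (Var x, Var y)) ` (set (tuple_var_occs ts) \<times> {k..<k'}) \<and>
     (\<forall>x. count_list (tuple_var_occs ts) x + of_bool (x \<in> V) \<ge> 2 \<longrightarrow> (\<exists>y. (Var x, Var y) \<in> C)) \<and>
     (\<exists>\<theta> \<in> CSubst_bot \<Sigma>. (\<forall>x. x \<notin> {k..<k'} \<longrightarrow> \<theta> x = Var x) \<and>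
        map (subst \<theta>) ts' = ts \<and> (\<forall>x y. (Var x, Var y) \<in> C \<longrightarrow> \<theta> y = Var x)) \<and>
     (\<forall>\<theta> \<in> CSubst_bot \<Sigma>. (\<forall>(a, b) \<in> C. subst \<theta> a = subst \<theta> b) \<longrightarrow>
        list_all2 (info_le \<Sigma>) (map (subst \<theta>) ts) (map (subst \<theta>) ts')))"

section \<open>Linearizing terms and tuples\<close>

lemma tuple_var_occs_simps [simp]:
  "tuple_var_occs [] = []"
  "tuple_var_occs (t # ts) = var_occs t @ tuple_var_occs ts"
  by (simp_all add: tuple_var_occs_def)

text \<open>The occurrences in a constructor term are expressed through its argument tuple, the form
  used by \<open>linearization\<close>. The defining equation would unfold this form again and
  leaves the simpset below.\<close>

lemma var_occs_Con [simp]: "var_occs (Con c ts) = tuple_var_occs ts"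
  by (simp add: tuple_var_occs_def)

declare var_occs.simps(3) [simp del]

lemma map_subst_cong:
  "(\<And>x. x \<in> set (tuple_var_occs ts) \<Longrightarrow> \<theta> x = \<theta>' x) \<Longrightarrow> map (subst \<theta>) ts = map (subst \<theta>') ts"
  by (auto simp: tuple_var_occs_def intro: subst_cong)

lemma CTerm_simps [simp]:
  "Var x \<in> CTerm \<Sigma>"
  "Con c ts \<in> CTerm \<Sigma> \<longleftrightarrow> c \<in> DS \<Sigma> (length ts) \<and> set ts \<subseteq> CTerm \<Sigma>"
  by (auto simp: CTerm_def)

lemma Var_mem_CSubst_bot: "Var \<in> CSubst_bot \<Sigma>"
  by (simp add: CSubst_bot_def)

lemma linearization_Nil: "linearization \<Sigma> V k [] ([], V, k, {})"
  using Var_mem_CSubst_bot by (auto simp: linearization_def)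

text \<open>The fresh variable is sent back to \<open>Bot\<close>; in the other direction,
  \<open>Bot\<close> lies below every instance of the fresh variable. Only here can an instance of
  the linearized tuple become strictly larger.\<close>

lemma linearization_Bot: "linearization \<Sigma> V k [Bot] ([Var k], V, Suc k, {})"
proof -
  have "Var(k := Bot) \<in> CSubst_bot \<Sigma>" "\<forall>x. x \<notin> {k..<Suc k} \<longrightarrow> (Var(k := Bot)) x = Var x"
    "map (subst (Var(k := Bot))) [Var k] = [Bot]"
    by (auto simp: CSubst_bot_def)
  then show ?thesis
    by (auto simp: linearization_def CSubst_bot_def intro: info_le.bot)
qed

text \<open>The fresh variable is sent back to the variable it replaces; in the other direction, the
  joinability statement forces both to have the same instance.\<close>

lemma linearization_Var_old:
  assumes "x \<in> V"
  shows "linearization \<Sigma> V k [Var x] ([Var k], V, Suc k, {(Var x, Var k)})"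
proof -
  have "Var(k := Var x) \<in> CSubst_bot \<Sigma>" "\<forall>y. y \<notin> {k..<Suc k} \<longrightarrow> (Var(k := Var x)) y = Var y"
    "map (subst (Var(k := Var x))) [Var k] = [Var x]"
    by (auto simp: CSubst_bot_def)
  then show ?thesis
    using assms by (auto simp: linearization_def CSubst_bot_def intro: info_le.refl)
qed

lemma linearization_Var_new:
  assumes "x \<notin> V"
  shows "linearization \<Sigma> V k [Var x] ([Var x], insert x V, k, {})"
  using assms Var_mem_CSubst_bot[of \<Sigma>]
  by (auto simp: linearization_def CSubst_bot_def intro: info_le.refl intro!: exI[of _ Var])

lemma linearization_Con:
  assumes "linearization \<Sigma> V k ts (ts', V', k', C)" and "c \<in> DS \<Sigma> (length ts)"
  shows "linearization \<Sigma> V k [Con c ts] ([Con c ts'], V', k', C)"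
  using assms unfolding linearization_def
  by (auto simp: info_le_Con)

text \<open>All original variables are below \<open>k\<close>, while the fresh ones of
  \<open>t'\<close> and \<open>ts'\<close> come from the disjoint intervals \<open>{k..<k'}\<close>
  and \<open>{k'..<k''}\<close>. Hence the two linearizations do not interfere, and their
  substitutions can be glued.\<close>

lemma linearization_Cons:
  assumes t: "linearization \<Sigma> V k [t] ([t'], V', k', C)"
    and ts: "linearization \<Sigma> V' k' ts (ts', V'', k'', D)"
    and bound: "V \<union> set (tuple_var_occs (t # ts)) \<subseteq> {..<k}"
  shows "linearization \<Sigma> V k (t # ts) (t' # ts', V'', k'', C \<union> D)"
proof -
  from t have t1: "k \<le> k'" "V' = V \<union> set (var_occs t)" "t' \<in> CTerm \<Sigma>" "distinct (var_occs t')"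
      "set (var_occs t') \<subseteq> (set (var_occs t) - V) \<union> {k..<k'}"
    and t2: "finite C" "C \<subseteq> (\<lambda>(x, y). (Var x, Var y)) ` (set (var_occs t) \<times> {k..<k'})"
      "\<And>x. count_list (var_occs t) x + of_bool (x \<in> V) \<ge> 2 \<Longrightarrow> \<exists>y. (Var x, Var y) \<in> C"
    and t3: "\<exists>\<theta> \<in> CSubst_bot \<Sigma>. (\<forall>x. x \<notin> {k..<k'} \<longrightarrow> \<theta> x = Var x) \<and>
        subst \<theta> t' = t \<and> (\<forall>x y. (Var x, Var y) \<in> C \<longrightarrow> \<theta> y = Var x)"
    and t4: "\<And>\<theta>. \<theta> \<in> CSubst_bot \<Sigma> \<Longrightarrow> \<forall>(a, b) \<in> C. subst \<theta> a = subst \<theta> b \<Longrightarrow>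
        info_le \<Sigma> (subst \<theta> t) (subst \<theta> t')"
    unfolding linearization_def by auto
  from ts have ts1: "k' \<le> k''" "V'' = V' \<union> set (tuple_var_occs ts)" "length ts' = length ts"
      "set ts' \<subseteq> CTerm \<Sigma>" "distinct (tuple_var_occs ts')"
      "set (tuple_var_occs ts') \<subseteq> (set (tuple_var_occs ts) - V') \<union> {k'..<k''}"
    and ts2: "finite D" "D \<subseteq> (\<lambda>(x, y). (Var x, Var y)) ` (set (tuple_var_occs ts) \<times> {k'..<k''})"
      "\<And>x. count_list (tuple_var_occs ts) x + of_bool (x \<in> V') \<ge> 2 \<Longrightarrow> \<exists>y. (Var x, Var y) \<in> D"
    and ts3: "\<exists>\<theta> \<in> CSubst_bot \<Sigma>. (\<forall>x. x \<notin> {k'..<k''} \<longrightarrow> \<theta> x = Var x) \<and>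
        map (subst \<theta>) ts' = ts \<and> (\<forall>x y. (Var x, Var y) \<in> D \<longrightarrow> \<theta> y = Var x)"
    and ts4: "\<And>\<theta>. \<theta> \<in> CSubst_bot \<Sigma> \<Longrightarrow> \<forall>(a, b) \<in> D. subst \<theta> a = subst \<theta> b \<Longrightarrow>
        list_all2 (info_le \<Sigma>) (map (subst \<theta>) ts) (map (subst \<theta>) ts')"
    unfolding linearization_def by auto
  \<comment> \<open>A variable common to \<open>t'\<close> and \<open>ts'\<close> could only be an
    original one, but those kept in \<open>ts'\<close> lie outside \<open>V'\<close>, which contains
    all variables of \<open>t\<close>.\<close>
  have distinct: "distinct (var_occs t' @ tuple_var_occs ts')"
    using t1 ts1 bound by fastforce
  have vars: "set (var_occs t' @ tuple_var_occs ts') \<subseteq>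
      (set (var_occs t @ tuple_var_occs ts) - V) \<union> {k..<k''}"
    using t1 ts1 by fastforce
  have pairs: "C \<union> D \<subseteq>
      (\<lambda>(x, y). (Var x, Var y)) ` (set (var_occs t @ tuple_var_occs ts) \<times> {k..<k''})"
  proof -
    have "set (var_occs t) \<times> {k..<k'} \<union> set (tuple_var_occs ts) \<times> {k'..<k''} \<subseteq>
        set (var_occs t @ tuple_var_occs ts) \<times> {k..<k''}"
      using t1(1) ts1(1) by auto
    then show ?thesis
      using t2(2) ts2(2) by blast
  qed
  have count: "\<exists>y. (Var x, Var y) \<in> C \<union> D"
    if "count_list (var_occs t @ tuple_var_occs ts) x + of_bool (x \<in> V) \<ge> 2" for x
  proof (cases "count_list (var_occs t) x + of_bool (x \<in> V) \<ge> 2")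
    case True
    then show ?thesis
      using t2(3) by blast
  next
    case False
    \<comment> \<open>Being at most 1, the count of \<open>x\<close> in \<open>t\<close> plus
      \<open>of_bool (x \<in> V)\<close> equals \<open>of_bool (x \<in> V')\<close>, so the total
      passes on to \<open>ts\<close> unchanged.\<close>
    have "x \<in> set (var_occs t) \<longleftrightarrow> count_list (var_occs t) x \<noteq> 0"
      by (simp add: count_list_0_iff)
    with False that t1(2) have "count_list (tuple_var_occs ts) x + of_bool (x \<in> V') \<ge> 2"
      by (auto split: if_splits)
    then show ?thesis
      using ts2(3) by blast
  qed
  have inverse: "\<exists>\<theta> \<in> CSubst_bot \<Sigma>. (\<forall>x. x \<notin> {k..<k''} \<longrightarrow> \<theta> x = Var x) \<and>
      map (subst \<theta>) (t' # ts') = t # ts \<and> (\<forall>x y. (Var x, Var y) \<in> C \<union> D \<longrightarrow> \<theta> y = Var x)"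
  proof -
    from t3 obtain \<theta>\<^sub>1 where \<theta>\<^sub>1: "\<theta>\<^sub>1 \<in> CSubst_bot \<Sigma>" "\<And>x. x \<notin> {k..<k'} \<Longrightarrow> \<theta>\<^sub>1 x = Var x"
      "subst \<theta>\<^sub>1 t' = t" "\<And>x y. (Var x, Var y) \<in> C \<Longrightarrow> \<theta>\<^sub>1 y = Var x"
      by blast
    from ts3 obtain \<theta>\<^sub>2 where \<theta>\<^sub>2: "\<theta>\<^sub>2 \<in> CSubst_bot \<Sigma>" "\<And>x. x \<notin> {k'..<k''} \<Longrightarrow> \<theta>\<^sub>2 x = Var x"
      "map (subst \<theta>\<^sub>2) ts' = ts" "\<And>x y. (Var x, Var y) \<in> D \<Longrightarrow> \<theta>\<^sub>2 y = Var x"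
      by blast
    \<comment> \<open>Cutting at \<open>k'\<close> is harmless: \<open>t'\<close> has only variables
      below \<open>k'\<close>, \<open>ts'\<close> only variables below \<open>k\<close> or from
      \<open>k'\<close> on, and both substitutions are the identity below \<open>k\<close>.\<close>
    let ?\<theta> = "\<lambda>x. if x < k' then \<theta>\<^sub>1 x else \<theta>\<^sub>2 x"
    have "subst ?\<theta> t' = subst \<theta>\<^sub>1 t'"
    proof (rule subst_cong)
      fix x assume "x \<in> set (var_occs t')"
      then have "x < k'"
        using t1(1,5) bound by fastforce
      then show "?\<theta> x = \<theta>\<^sub>1 x"
        by simp
    qed
    moreover have "map (subst ?\<theta>) ts' = map (subst \<theta>\<^sub>2) ts'"
    proof (rule map_subst_cong)
      fix x assume "x \<in> set (tuple_var_occs ts')"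
      then have "x < k \<or> k' \<le> x"
        using ts1(6) bound by fastforce
      then show "?\<theta> x = \<theta>\<^sub>2 x"
        using \<theta>\<^sub>1(2) \<theta>\<^sub>2(2) by auto
    qed
    moreover have "?\<theta> y = Var x" if "(Var x, Var y) \<in> C \<union> D" for x y
    proof -
      have "y < k'" if "(Var x, Var y) \<in> C"
        using that t2(2) by auto
      moreover have "k' \<le> y" if "(Var x, Var y) \<in> D"
        using that ts2(2) by auto
      ultimately show ?thesis
        using that \<theta>\<^sub>1(4) \<theta>\<^sub>2(4) by fastforce
    qed
    moreover have "?\<theta> \<in> CSubst_bot \<Sigma>"
      using \<theta>\<^sub>1(1) \<theta>\<^sub>2(1) by (simp add: CSubst_bot_def)
    moreover have "?\<theta> x = Var x" if "x \<notin> {k..<k''}" for x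
      using that \<theta>\<^sub>1(2) \<theta>\<^sub>2(2) t1(1) ts1(1) by auto
    ultimately show ?thesis
      using \<theta>\<^sub>1(3) \<theta>\<^sub>2(3) by (intro bexI[of _ ?\<theta>]) simp_all
  qed
  have "list_all2 (info_le \<Sigma>) (map (subst \<theta>) (t # ts)) (map (subst \<theta>) (t' # ts'))"
    if "\<theta> \<in> CSubst_bot \<Sigma>" "\<forall>(a, b) \<in> C \<union> D. subst \<theta> a = subst \<theta> b" for \<theta>
    using that t4[of \<theta>] ts4[of \<theta>] by auto
  moreover have "k \<le> k''" "V'' = V \<union> set (tuple_var_occs (t # ts))"
    "length (t' # ts') = length (t # ts)" "set (t' # ts') \<subseteq> CTerm \<Sigma>" "finite (C \<union> D)"
    using t1 ts1 t2(1) ts2(1) by auto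
  ultimately show ?thesis
    unfolding linearization_def prod.case tuple_var_occs_simps
    using distinct vars pairs count inverse by blast
qed

text \<open>A single term is treated as a tuple of length one, so that one invariant serves both
  mutually recursive functions. The bound on the variables survives each step because the counter
  never decreases.\<close>

lemma linearization_linearize:
  "t \<in> CTerm_bot \<Sigma> \<Longrightarrow> V \<union> set (var_occs t) \<subseteq> {..<k} \<Longrightarrow>
    linearization \<Sigma> V k [t] (case linearize V k t of (t', rest) \<Rightarrow> ([t'], rest))"
  "set ts \<subseteq> CTerm_bot \<Sigma> \<Longrightarrow> V \<union> set (tuple_var_occs ts) \<subseteq> {..<k} \<Longrightarrow>
    linearization \<Sigma> V k ts (linearize_tuple V k ts)"
proof (induction V k t and V k ts rule: linearize_linearize_tuple.induct)
  case (1 V k)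
  show ?case
    by (simp add: linearization_Bot)
next
  case (2 V k x)
  show ?case
    by (simp add: linearization_Var_old linearization_Var_new)
next
  case (3 V k c ts)
  then show ?case
    by (auto simp: linearization_Con split: prod.split)
next
  case (6 V k t ts)
  obtain t' V' k' C where t': "linearize V k t = (t', V', k', C)"
    using prod_cases4 by blast
  obtain ts' V'' k'' D where ts': "linearize_tuple V' k' ts = (ts', V'', k'', D)"
    using prod_cases4 by blast
  have t: "linearization \<Sigma> V k [t] ([t'], V', k', C)"
    using "6.IH"(1) "6.prems" by (simp add: t')
  then have "k \<le> k'" "V' = V \<union> set (var_occs t)"
    by (auto simp: linearization_def)
  then have "V' \<union> set (tuple_var_occs ts) \<subseteq> {..<k'}"
    using "6.prems"(2) by fastforce
  then have "linearization \<Sigma> V' k' ts (ts', V'', k'', D)"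
    using "6.IH"(2)[OF t'[symmetric] HOL.refl HOL.refl HOL.refl] "6.prems" by (simp add: ts')
  then show ?case
    using linearization_Cons[OF t] "6.prems"(2) by (simp add: t' ts')
qed (simp_all add: linearization_Nil)

section \<open>Provability and validity of the rules \<open>crr\<close>\<close>

lemma crr_cases:
  assumes "set ts \<subseteq> CTerm_bot \<Sigma>"
  obtains ts' V' k k' C where "linearization \<Sigma> {} k ts (ts', V', k', C)"
    "set (tuple_var_occs ts) \<union> set (var_occs r) \<subseteq> {..<k}"
    "crr f ts r = Rule f ts' r (C \<union> {(Var x, Var x) | x.
       x \<in> set (var_occs r) \<or> count_list (tuple_var_occs ts) x = 1})"
proof -
  \<comment> \<open>The start lies above the variables of \<open>r\<close> as well, so undoing the
    linearization leaves \<open>r\<close> unchanged. The inserted 0 keeps \<open>Max\<close>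
    meaningful when there are no variables.\<close>
  define k where "k = Suc (Max (insert 0 (set (tuple_var_occs ts) \<union> set (var_occs r))))"
  have bound: "set (tuple_var_occs ts) \<union> set (var_occs r) \<subseteq> {..<k}"
    by (auto simp: k_def less_Suc_eq_le)
  obtain ts' V' k' C where lin: "linearize_tuple {} k ts = (ts', V', k', C)"
    using prod_cases4 by blast
  have "linearization \<Sigma> {} k ts (ts', V', k', C)"
    using linearization_linearize(2)[OF assms, of "{}" k] bound by (simp add: lin)
  then show thesis
    using bound by (rule that) (simp add: crr_def lin flip: k_def)
qed

lemma program_rule_crr:
  fixes \<Sigma> :: "('c, 'f) signature"
  assumes f: "f \<in> FS \<Sigma> n" and ts: "ts \<in> CTuple_bot \<Sigma> n" and r: "r \<in> CTerm_bot \<Sigma>"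
  shows "program_rule \<Sigma> (crr f ts r)"
proof -
  have sub: "set ts \<subseteq> CTerm_bot \<Sigma>"
    using ts by (simp add: CTuple_bot_def)
  obtain ts' V' k k' C where lin: "linearization \<Sigma> {} k ts (ts', V', k', C)"
    and crr: "crr f ts r = Rule f ts' r (C \<union> {(Var x, Var x) | x.
       x \<in> set (var_occs r) \<or> count_list (tuple_var_occs ts) x = 1})"
    by (rule crr_cases[OF sub])
  have "{(Var x, Var x) | x. x \<in> set (var_occs r) \<or> count_list (tuple_var_occs ts) x = 1} \<subseteq>
      (\<lambda>x. (Var x, Var x)) ` (set (var_occs r) \<union> set (tuple_var_occs ts))"
    by (auto simp: image_iff)
  then have "finite {(Var x, Var x) :: ('c, 'f) tm \<times> ('c, 'f) tm | x.
      x \<in> set (var_occs r) \<or> count_list (tuple_var_occs ts) x = 1}"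
    by (rule finite_subset) simp
  moreover have "C \<subseteq> Term \<Sigma> \<times> Term \<Sigma>"
  proof -
    have "C \<subseteq> (\<lambda>(x, y). (Var x, Var y)) ` (set (tuple_var_occs ts) \<times> {k..<k'})"
      using lin unfolding linearization_def by simp
    also have "\<dots> \<subseteq> Term \<Sigma> \<times> Term \<Sigma>"
      by (auto simp: Term_def Term_bot.intros)
    finally show ?thesis .
  qed
  moreover have "{(Var x, Var x) | x. x \<in> set (var_occs r) \<or> count_list (tuple_var_occs ts) x = 1} \<subseteq>
      Term \<Sigma> \<times> Term \<Sigma>"
    by (auto simp: Term_def Term_bot.intros)
  moreover have "length ts' = length ts" "set ts' \<subseteq> CTerm \<Sigma>" "distinct (tuple_var_occs ts')" "finite C"
    using lin unfolding linearization_def by simp_all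
  moreover have "length ts = n" "r \<in> Term_bot \<Sigma>"
    using ts r CTerm_bot_subset_Term_bot by (auto simp: CTuple_bot_def)
  ultimately show ?thesis
    using f unfolding crr program_rule_def by simp
qed

text \<open>Sending the fresh variables back to what they replaced recovers the arguments
  \<open>ts\<close> and the right-hand side \<open>r\<close>. The conditions become trivial, since a
  variable is total and joinable with itself.\<close>

lemma crwl_crr:
  assumes f: "f \<in> FS \<Sigma> n" and ts: "ts \<in> CTuple_bot \<Sigma> n" and r: "r \<in> CTerm_bot \<Sigma>" "r \<noteq> Bot"
    and R: "crr f ts r \<in> \<R>"
  shows "crwl \<Sigma> \<R> (Red (Fun f ts) r)"
proof -
  have sub: "set ts \<subseteq> CTerm_bot \<Sigma>"
    using ts by (simp add: CTuple_bot_def)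
  obtain ts' V' k k' C where lin: "linearization \<Sigma> {} k ts (ts', V', k', C)"
    and bound: "set (tuple_var_occs ts) \<union> set (var_occs r) \<subseteq> {..<k}"
    and crr: "crr f ts r = Rule f ts' r (C \<union> {(Var x, Var x) | x.
       x \<in> set (var_occs r) \<or> count_list (tuple_var_occs ts) x = 1})" (is "_ = Rule _ _ _ ?D")
    by (rule crr_cases[OF sub])
  from lin obtain \<theta> where \<theta>: "\<theta> \<in> CSubst_bot \<Sigma>" "\<And>x. x \<notin> {k..<k'} \<Longrightarrow> \<theta> x = Var x"
      "map (subst \<theta>) ts' = ts" "\<And>x y. (Var x, Var y) \<in> C \<Longrightarrow> \<theta> y = Var x"
    and C: "C \<subseteq> (\<lambda>(x, y). (Var x, Var y)) ` (set (tuple_var_occs ts) \<times> {k..<k'})"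
    unfolding linearization_def by blast
  have below: "\<theta> x = Var x" if "x < k" for x
    using that \<theta>(2) by simp
  have "subst \<theta> r = subst Var r"
    using below bound by (intro subst_cong) auto
  then have inst: "Rule f ts r ((\<lambda>(a, b). (subst \<theta> a, subst \<theta> b)) ` ?D) \<in> instances \<Sigma> \<R>"
    unfolding instances_def using \<theta>(1,3) R
    by (intro CollectI exI[of _ \<theta>] exI[of _ "crr f ts r"]) (simp add: crr)
  have D: "\<exists>x. subst \<theta> a = Var x \<and> subst \<theta> b = Var x" if ab: "(a, b) \<in> ?D" for a b
  proof (cases "(a, b) \<in> C")
    case True
    then obtain x y where "a = Var x" "b = Var y" "x \<in> set (tuple_var_occs ts)"
      using C by auto
    moreover from this have "x < k"
      using bound by auto
    ultimately show ?thesis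
      using True \<theta>(4) below by auto
  next
    case False
    then obtain x where x: "a = Var x" "b = Var x"
      and "x \<in> set (var_occs r) \<or> count_list (tuple_var_occs ts) x = 1"
      using ab by auto
    then have "x < k"
      using bound by (metis Un_iff count_notin lessThan_iff subsetD zero_neq_one)
    then show ?thesis
      using x below by auto
  qed
  have "crwl \<Sigma> \<R> (Join a b)" if "(a, b) \<in> (\<lambda>(a, b). (subst \<theta> a, subst \<theta> b)) ` ?D" for a b
    using that D by (force intro: crwl.Jo crwl.RR_var)
  moreover have "crwl \<Sigma> \<R> (Red (ts ! i) (ts ! i))" if "i < n" for i
    using that ts by (auto simp: CTuple_bot_def intro!: crwl_info_le info_le.refl)
  ultimately show ?thesis
    using inst f ts r by (intro crwl.OR[OF inst f]) (auto simp: CTuple_bot_def intro!: crwl_info_le info_le.refl)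
qed

text \<open>The conditions make \<theta> total on the variables of \<open>ts\<close> and
  \<open>r\<close>, so consistency puts \<open>subst \<theta> r\<close> into the value at the
  instance of \<open>ts\<close>. That instance lies below \<open>us\<close>, and monotonicity does
  the rest.\<close>

lemma crr_instance_sound:
  assumes A: "\<A> \<in> CTAlg \<Sigma>" and f: "f \<in> FS \<Sigma> n" and ts: "ts \<in> CTuple_bot \<Sigma> n"
    and r: "r \<in> \<A> f ts" and \<theta>: "\<theta> \<in> CSubst_bot \<Sigma>"
    and inst: "subst_rule \<theta> (crr f ts r) = Rule f ss r' D" and us: "us \<in> CTuple_bot \<Sigma> n"
    and le: "list_all2 (info_le \<Sigma>) ss us" and sat: "sat_conds \<Sigma> \<A> Var D"
  shows "eval \<Sigma> \<A> Var r' \<subseteq> \<A> f us"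
proof -
  have TAlg: "\<A> \<in> TAlg \<Sigma>" and cons: "consistent \<Sigma> \<A>"
    using A by (auto simp: CTAlg_def)
  have sub: "set ts \<subseteq> CTerm_bot \<Sigma>"
    using ts by (simp add: CTuple_bot_def)
  have r_CTerm: "r \<in> CTerm_bot \<Sigma>"
    using TAlg_cone[OF TAlg f ts] r by (auto simp: cone_def)
  obtain ts' V' k k' C where lin: "linearization \<Sigma> {} k ts (ts', V', k', C)"
    and crr: "crr f ts r = Rule f ts' r (C \<union> {(Var x, Var x) | x.
       x \<in> set (var_occs r) \<or> count_list (tuple_var_occs ts) x = 1})" (is "_ = Rule _ _ _ ?D")
    by (rule crr_cases[OF sub])
  have ss: "ss = map (subst \<theta>) ts'" and r': "r' = subst \<theta> r"
    and D: "D = (\<lambda>(a, b). (subst \<theta> a, subst \<theta> b)) ` ?D"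
    using inst by (simp_all add: crr)
  have total: "\<theta> x = \<theta> y" "\<theta> x \<in> CTerm \<Sigma>" if "(Var x, Var y) \<in> ?D" for x y
  proof -
    have "(\<theta> x, \<theta> y) \<in> D"
      unfolding D using that by force
    then have "sat_join \<Sigma> \<A> Var (\<theta> x) (\<theta> y)"
      using sat by (auto simp: sat_conds_def)
    moreover have "\<theta> x \<in> CTerm_bot \<Sigma>" "\<theta> y \<in> CTerm_bot \<Sigma>"
      using \<theta> by (auto simp: CSubst_bot_def)
    ultimately show "\<theta> x = \<theta> y" "\<theta> x \<in> CTerm \<Sigma>"
      by (rule sat_join_CTerm_bot)+
  qed
  have lin': "\<And>x. count_list (tuple_var_occs ts) x \<ge> 2 \<Longrightarrow> \<exists>y. (Var x, Var y) \<in> C"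
    and C: "C \<subseteq> (\<lambda>(x, y). (Var x, Var y)) ` (set (tuple_var_occs ts) \<times> {k..<k'})"
    and le': "\<forall>(a, b) \<in> C. subst \<theta> a = subst \<theta> b \<Longrightarrow> list_all2 (info_le \<Sigma>) (map (subst \<theta>) ts) ss"
    using lin \<theta> unfolding linearization_def ss by auto
  have "\<forall>(a, b) \<in> C. subst \<theta> a = subst \<theta> b"
    using C total(1) by auto
  \<comment> \<open>Here \<open>ss\<close> may lie strictly above the instance of \<open>ts\<close>,
    namely where a fresh variable stands for \<open>Bot\<close>.\<close>
  note le'' = list_all2_info_le_trans[OF le'[OF this] le]
  \<comment> \<open>Elsewhere \<theta> may be partial, for instance on the fresh variables for
    \<open>Bot\<close>; resetting it to the identity there gives a member of
    \<open>CSubst\<close>.\<close>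
  define \<theta>' where "\<theta>' x = (if x \<in> set (tuple_var_occs ts) \<union> set (var_occs r) then \<theta> x else Var x)" for x
  \<comment> \<open>Variables of \<open>r\<close> and those occurring once in \<open>ts\<close> have
    a condition with themselves; a repeated variable has one with a fresh copy.\<close>
  have "\<theta> x \<in> CTerm \<Sigma>" if "x \<in> set (tuple_var_occs ts) \<union> set (var_occs r)" for x
  proof (cases "x \<in> set (var_occs r) \<or> count_list (tuple_var_occs ts) x = 1")
    case True
    then show ?thesis
      using total(2)[of x x] by blast
  next
    case False
    with that have "count_list (tuple_var_occs ts) x \<noteq> 0" "count_list (tuple_var_occs ts) x \<noteq> 1"
      by (auto simp: count_list_0_iff)
    then obtain y where "(Var x, Var y) \<in> C"
      using lin'[of x] by force
    then show ?thesis
      using total(2) by blast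
  qed
  then have \<theta>': "\<theta>' \<in> CSubst \<Sigma>"
    by (simp add: CSubst_def \<theta>'_def)
  have eq: "map (subst \<theta>') ts = map (subst \<theta>) ts" "subst \<theta>' r = subst \<theta> r"
    by (auto simp: \<theta>'_def intro!: map_subst_cong subst_cong simp del: map_eq_conv)
  have "subst \<theta> r \<in> \<A> f (map (subst \<theta>) ts)"
    using cons f ts \<theta>' r unfolding consistent_def eq[symmetric] by blast
  moreover have "map (subst \<theta>) ts \<in> CTuple_bot \<Sigma> n"
    using ts \<theta> by (auto simp: CTuple_bot_def intro: subst_mem_CTerm_bot)
  ultimately have "r' \<in> \<A> f us"
    using TAlg_mono[OF TAlg f _ us le''] r' by blast
  moreover have "r' \<in> CTerm_bot \<Sigma>"
    using r_CTerm \<theta> by (simp add: r' subst_mem_CTerm_bot)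
  ultimately show ?thesis
    using cone_closed[OF TAlg_cone[OF TAlg f us]] by (auto simp: eval_CTerm_bot down_def)
qed

section \<open>Full abstraction\<close>

text \<open>Values equal to \<open>Bot\<close> get no rule, since modules exclude that right-hand
  side; \<open>Bo\<close> derives them anyway. Linearization is what makes partial or repeating
  argument tuples admissible as left-hand sides.\<close>

definition graph_module :: "('c, 'f) signature \<Rightarrow> ('c, 'f) alg \<Rightarrow> ('c, 'f) rule set" where
  "graph_module \<Sigma> \<A> =
     {crr f ts r | f ts r n. f \<in> FS \<Sigma> n \<and> ts \<in> CTuple_bot \<Sigma> n \<and> r \<in> \<A> f ts \<and> r \<noteq> Bot}"

lemma rule_sel_crr [simp]: "rule_fun (crr f ts r) = f" "rule_rhs (crr f ts r) = r"
  by (auto simp: crr_def Let_def split: prod.split)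

lemma is_module_graph_module:
  assumes "\<A> \<in> TAlg \<Sigma>"
  shows "is_module \<Sigma> (graph_module \<Sigma> \<A>)"
proof -
  have "program_rule \<Sigma> (crr f ts r)"
    if "f \<in> FS \<Sigma> n" "ts \<in> CTuple_bot \<Sigma> n" "r \<in> \<A> f ts" for f ts r n
    using program_rule_crr[OF that(1,2)] TAlg_cone[OF assms that(1,2)] that(3)
    by (auto simp: cone_def)
  then show ?thesis
    by (auto simp: is_module_def program_def graph_module_def)
qed

lemma graph_module_model:
  assumes A: "\<A> \<in> CTAlg \<Sigma>"
  shows "alg_le \<Sigma> (T_op \<Sigma> (graph_module \<Sigma> \<A>) \<A>) \<A>"
  unfolding alg_le_def
proof (intro allI ballI subsetI)
  fix n f us t
  assume f: "f \<in> FS \<Sigma> n" and us: "us \<in> CTuple_bot \<Sigma> n"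
    and t: "t \<in> T_op \<Sigma> (graph_module \<Sigma> \<A>) \<A> f us"
  show "t \<in> \<A> f us"
  proof (cases "t = Bot")
    case True
    then show ?thesis
      using A cone_Bot TAlg_cone[OF _ f us] by (auto simp: CTAlg_def)
  next
    case False
    with t obtain ss r' D where inst: "Rule f ss r' D \<in> instances \<Sigma> (graph_module \<Sigma> \<A>)"
      and le: "list_all2 (info_le \<Sigma>) ss us"
      and sat: "sat_conds \<Sigma> \<A> Var D" and ev: "t \<in> eval \<Sigma> \<A> Var r'"
      by (auto simp: T_op_def split: if_splits)
    from inst obtain \<theta> g ts r m where \<theta>: "\<theta> \<in> CSubst_bot \<Sigma>"
      and eq: "subst_rule \<theta> (crr g ts r) = Rule f ss r' D"
      and g: "g \<in> FS \<Sigma> m" "ts \<in> CTuple_bot \<Sigma> m" "r \<in> \<A> g ts"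
      unfolding instances_def graph_module_def by auto
    \<comment> \<open>Substitution keeps the head symbol, so the rule defines \<open>f\<close>, and
      a symbol has only one arity.\<close>
    have "rule_fun (subst_rule \<theta> R) = rule_fun R" for R
      by (cases R) simp
    then have "g = f"
      using eq by (metis rule.sel(1) rule_sel_crr(1))
    moreover from this have "m = n"
      using f g(1) by (simp add: FS_def)
    ultimately show ?thesis
      using crr_instance_sound[OF A f _ _ \<theta> _ us le sat] g eq ev by blast
  qed
qed

text \<open>Each value other than \<open>Bot\<close> is derived by its own rule. Allowing any
  superset of the graph module leaves room for the rules of the module under observation.\<close>

lemma alg_le_M_alg_graph_module:
  assumes A: "\<A> \<in> TAlg \<Sigma>" and "graph_module \<Sigma> \<A> \<subseteq> \<R>"
  shows "alg_le \<Sigma> \<A> (M_alg \<Sigma> \<R>)"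
  unfolding alg_le_def
proof (intro allI ballI subsetI)
  fix n f ts t
  assume f: "f \<in> FS \<Sigma> n" and ts: "ts \<in> CTuple_bot \<Sigma> n" and t: "t \<in> \<A> f ts"
  have t': "t \<in> CTerm_bot \<Sigma>"
    using TAlg_cone[OF A f ts] t by (auto simp: cone_def)
  have "crwl \<Sigma> \<R> (Red (Fun f ts) t)"
  proof (cases "t = Bot")
    case True
    have "Fun f ts \<in> Term_bot \<Sigma>"
      using f ts CTerm_bot_subset_Term_bot by (auto simp: Fun_mem_Term_bot CTuple_bot_def)
    then show ?thesis
      by (simp add: True crwl.Bo)
  next
    case False
    then have "crr f ts t \<in> \<R>"
      using assms(2) f ts t unfolding graph_module_def by blast
    then show ?thesis
      using crwl_crr[OF f ts t' False] by blast
  qed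
  then show "t \<in> M_alg \<Sigma> \<R> f ts"
    using f ts t' by (auto simp: M_alg_def)
qed

text \<open>The ordering compares algebras only on the intended domain; outside it both are empty,
  so equality as functions follows.\<close>

lemma alg_le_antisym:
  assumes "\<A> \<in> TAlg \<Sigma>" "alg_le \<Sigma> (M_alg \<Sigma> \<R>) \<A>" "alg_le \<Sigma> \<A> (M_alg \<Sigma> \<R>)"
  shows "M_alg \<Sigma> \<R> = \<A>"
proof (intro ext)
  fix f ts
  show "M_alg \<Sigma> \<R> f ts = \<A> f ts"
  proof (cases "\<exists>n. f \<in> FS \<Sigma> n \<and> ts \<in> CTuple_bot \<Sigma> n")
    case True
    then show ?thesis
      using assms(2,3) unfolding alg_le_def by blast
  next
    case False
    then show ?thesis
      using TAlg_outside[OF assms(1) False] by (auto simp: M_alg_def)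
  qed
qed

text \<open>For a fixed algebra each rule contributes independently of the others, so the models of
  a union are the common models of its parts.\<close>

lemma alg_le_T_op_Un:
  "alg_le \<Sigma> (T_op \<Sigma> (\<R> \<union> \<S>) \<A>) \<B> \<longleftrightarrow>
    alg_le \<Sigma> (T_op \<Sigma> \<R> \<A>) \<B> \<and> alg_le \<Sigma> (T_op \<Sigma> \<S> \<A>) \<B>"
proof -
  have "T_op \<Sigma> (\<R> \<union> \<S>) \<A> f ts = T_op \<Sigma> \<R> \<A> f ts \<union> T_op \<Sigma> \<S> \<A> f ts" for f ts
    unfolding T_op_def instances_Un by auto
  then show ?thesis
    unfolding alg_le_def by blast
qed

text \<open>Being a model, a property not observed directly, becomes an equation between \<A> and
  the observable of a union.\<close>

lemma M_alg_graph_module_iff_model: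
  assumes A: "\<A> \<in> CTAlg \<Sigma>" and P: "is_module \<Sigma> \<P>"
  shows "M_alg \<Sigma> (\<P> \<union> graph_module \<Sigma> \<A>) = \<A> \<longleftrightarrow> alg_le \<Sigma> (T_op \<Sigma> \<P> \<A>) \<A>"
proof
  have TAlg: "\<A> \<in> TAlg \<Sigma>"
    using A by (simp add: CTAlg_def)
  have prog: "program \<Sigma> (\<P> \<union> graph_module \<Sigma> \<A>)"
    using P is_module_graph_module[OF TAlg] by (auto simp: is_module_def program_def)
  show "alg_le \<Sigma> (T_op \<Sigma> \<P> \<A>) \<A>" if "M_alg \<Sigma> (\<P> \<union> graph_module \<Sigma> \<A>) = \<A>"
    \<comment> \<open>The assumed equation also supplies that the term model belongs to
      \<open>TAlg\<close>.\<close>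
    using M_alg_model[OF prog] TAlg that by (simp add: alg_le_T_op_Un)
  show "M_alg \<Sigma> (\<P> \<union> graph_module \<Sigma> \<A>) = \<A>" if "alg_le \<Sigma> (T_op \<Sigma> \<P> \<A>) \<A>"
    using that graph_module_model[OF A]
    by (intro alg_le_antisym TAlg M_alg_least alg_le_M_alg_graph_module)
      (simp_all add: alg_le_T_op_Un)
qed

theorem theorem6p14:
  fixes \<Sigma> :: "('c, 'f) signature"
    and \<P> \<Q> :: "('c, 'f) rule set"
  assumes "countable_signature \<Sigma>"
    and "is_module \<Sigma> \<P>"
    and "is_module \<Sigma> \<Q>"
    and "\<And>K. K \<in> Contexts \<Sigma> \<Longrightarrow> Ob \<Sigma> (plug \<Sigma> K \<P>) = Ob \<Sigma> (plug \<Sigma> K \<Q>)"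
  shows "CM_equiv \<Sigma> \<P> \<Q>"
  unfolding CM_equiv_def
proof
  fix \<A> assume A: "\<A> \<in> CTAlg \<Sigma>"
  then have "is_module \<Sigma> (graph_module \<Sigma> \<A>)"
    by (simp add: CTAlg_def is_module_graph_module)
  \<comment> \<open>For each \<A> a single context suffices: the union of the hole with the graph
    module of \<A>.\<close>
  then have "Union Hole (Module (graph_module \<Sigma> \<A>)) \<in> Contexts \<Sigma>"
    by (intro Contexts.intros)
  from assms(4)[OF this] have "M_alg \<Sigma> (\<P> \<union> graph_module \<Sigma> \<A>) = M_alg \<Sigma> (\<Q> \<union> graph_module \<Sigma> \<A>)"
    by (simp add: Ob_def mod_union_def)
  then show "alg_le \<Sigma> (T_op \<Sigma> \<P> \<A>) \<A> \<longleftrightarrow> alg_le \<Sigma> (T_op \<Sigma> \<Q> \<A>) \<A>"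
    using M_alg_graph_module_iff_model[OF A assms(2)] M_alg_graph_module_iff_model[OF A assms(3)]
    by simp
qed

end
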